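(* Let $m,n\in\mathbb{N}$, and let $\alpha\in\mathcal{PB}_{m}$ and $\beta\in\mathcal{PB}_{n}$ with $r=\operatorname{rank}(\alpha)\geq 1$ and $s=\operatorname{rank}(\beta)\geq 1$. Write $k$ and $l$ for the number of singleton classes in $\ker(\alpha)$ and $\ker(\beta)$, respectively. Similarly, write $p$ and $w$ for the number of singleton classes in $\operatorname{coker}(\alpha)$ and $\operatorname{coker}(\beta)$, respectively. Then the variants $\mathcal{PB}^{\alpha}_{m}$ and $\mathcal{PB}^{\beta}_{n}$ are isomorphic as semigroups if and only if $m=n$, $k=l$, $p=w$, and $r=s$.
   Context: $\mathbb{N}=\{0,1,2,\ldots\}$, $[n]=\{1,\ldots,n\}$ (with $[0]=\emptyset$), and $[n]'=\{1',\ldots,n'\}$ is a disjoint copy of $[n]$. The partial Brauer monoid $\mathcal{PB}_n$ is the set of all partitions of $[n]\cup[n]'$ into blocks of size at most $2$, with the following product. For $\alpha,\beta\in\mathcal{PB}_n$, let $\Pi(\alpha,\beta)$ be the graph on $[n]\cup[n]''\cup[n]'$ (with $[n]''$ another disjoint copy of $[n]$) obtained by drawing $\alpha$ as a graph (the vertices of each two-element block joined by an edge) with every lower vertex $x'$ renamed $x''$, drawing $\beta$ with every upper vertex $x$ renamed $x''$, and identifying the two copies of $[n]''$. Then $\alpha\beta\in\mathcal{PB}_n$ is the partition in which distinct $i,j\in[n]\cup[n]'$ form a block $\{i,j\}$ if and only if $i$ and $j$ are connected by a path in $\Pi(\alpha,\beta)$. A transversal of $\alpha\in\mathcal{PB}_n$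 is a block containing elements of both $[n]$ and $[n]'$; $\operatorname{rank}(\alpha)$ is the number of transversals. $\ker(\alpha)$ is the equivalence on $[n]$ relating $x,y$ iff $x$ and $y$ belong to the same block of $\alpha$; $\operatorname{coker}(\alpha)$ is the equivalence on $[n]$ relating $x,y$ iff $x'$ and $y'$ belong to the same block of $\alpha$. (So an element belonging to a transversal forms a singleton class of the kernel, resp. cokernel.) The variant $\mathcal{PB}_n^{\alpha}$ is the semigroup on the set $\mathcal{PB}_n$ with operation $\xi\star_{\alpha}\eta=\xi\alpha\eta$. *)

theory Defs
  imports "HOL-Algebra.Group" "HOL-Library.Disjoint_Sets"
begin

text \<open>
  \<open>Upper i\<close>, \<open>Lower i\<close> and \<open>Middle i\<close> stand for \<open>i\<close>, \<open>i'\<close> and \<open>i''\<close>.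
  Middle vertices occur only in product graphs, never in diagrams.
\<close>

datatype vertex = Upper nat | Middle nat | Lower nat

definition diagram_vertices :: "nat \<Rightarrow> vertex set" where
  "diagram_vertices n = Upper ` {1..n} \<union> Lower ` {1..n}"

type_synonym diagram = "vertex set set"

definition partial_brauer_diagrams :: "nat \<Rightarrow> diagram set" where
  "partial_brauer_diagrams n =
     {\<alpha>. partition_on (diagram_vertices n) \<alpha> \<and> (\<forall>B\<in>\<alpha>. card B \<le> 2)}"

fun lower_to_middle :: "vertex \<Rightarrow> vertex" where
  "lower_to_middle (Lower i) = Middle i"
| "lower_to_middle v = v"

fun upper_to_middle :: "vertex \<Rightarrow> vertex" where
  "upper_to_middle (Upper i) = Middle i"
| "upper_to_middle v = v"

definition diagram_edges :: "diagram \<Rightarrow> (vertex \<times> vertex) set" where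
  "diagram_edges \<alpha> = {(u, v). u \<noteq> v \<and> {u, v} \<in> \<alpha>}"

text \<open>The adjacency relation (symmetric) of \<open>\<Pi>(\<alpha>, \<beta>)\<close>.\<close>

definition product_graph :: "diagram \<Rightarrow> diagram \<Rightarrow> (vertex \<times> vertex) set" where
  "product_graph \<alpha> \<beta> =
     map_prod lower_to_middle lower_to_middle ` diagram_edges \<alpha> \<union>
     map_prod upper_to_middle upper_to_middle ` diagram_edges \<beta>"

definition diagram_mult :: "nat \<Rightarrow> diagram \<Rightarrow> diagram \<Rightarrow> diagram" where
  "diagram_mult n \<alpha> \<beta> =
     (let V = diagram_vertices n; connected = (product_graph \<alpha> \<beta>)\<^sup>*
      in {{i, j} | i j. i \<in> V \<and> j \<in> V \<and> i \<noteq> j \<and> (i, j) \<in> connected} \<union>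
         {{i} | i. i \<in> V \<and> \<not> (\<exists>j\<in>V. i \<noteq> j \<and> (i, j) \<in> connected)})"

definition PB :: "nat \<Rightarrow> diagram monoid" where
  "PB n = \<lparr>carrier = partial_brauer_diagrams n, mult = diagram_mult n,
           one = (\<lambda>i. {Upper i, Lower i}) ` {1..n}\<rparr>"

text \<open>
  A variant is only a semigroup, so the \<open>one\<close> field carries no information. It plays no role
  in \<^const>\<open>hom\<close> and \<^const>\<open>iso\<close>, which refer only to the carrier and the multiplication.
\<close>

definition variant :: "('a, 'b) monoid_scheme \<Rightarrow> 'a \<Rightarrow> 'a monoid" where
  "variant M a = \<lparr>carrier = carrier M, mult = (\<lambda>x y. x \<otimes>\<^bsub>M\<^esub> a \<otimes>\<^bsub>M\<^esub> y), one = undefined\<rparr>"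

definition transversals :: "diagram \<Rightarrow> vertex set set" where
  "transversals \<alpha> = {B \<in> \<alpha>. (\<exists>i. Upper i \<in> B) \<and> (\<exists>j. Lower j \<in> B)}"

definition diagram_rank :: "diagram \<Rightarrow> nat" where
  "diagram_rank \<alpha> = card (transversals \<alpha>)"

definition diagram_ker :: "nat \<Rightarrow> diagram \<Rightarrow> (nat \<times> nat) set" where
  "diagram_ker n \<alpha> =
     {(x, y). x \<in> {1..n} \<and> y \<in> {1..n} \<and> (\<exists>B\<in>\<alpha>. Upper x \<in> B \<and> Upper y \<in> B)}"

definition diagram_coker :: "nat \<Rightarrow> diagram \<Rightarrow> (nat \<times> nat) set" where
  "diagram_coker n \<alpha> =
     {(x, y). x \<in> {1..n} \<and> y \<in> {1..n} \<and> (\<exists>B\<in>\<alpha>. Lower x \<in> B \<and> Lower y \<in> B)}"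

definition singleton_classes :: "'a set \<Rightarrow> ('a \<times> 'a) set \<Rightarrow> 'a set set" where
  "singleton_classes A R = {C \<in> A // R. is_singleton C}"

end

theory Submission
  imports Defs "HOL-Combinatorics.Permutations"
begin

text \<open>
  A diagram is the same thing as a matching (its two-element blocks) on the \<open>2n\<close> boundary vertices,
  and a product of diagrams is the connectivity relation of a union of two matchings, restricted to
  the boundary. All vertices of such a union have degree at most two, so its components are paths
  and cycles, and a path has only two ends (\<open>three_ends_not_connected\<close>).

  If the four parameters agree, there are permutations of the upper and of the lower points that
  turn \<open>\<alpha>\<close> into \<open>\<beta>\<close>, and relabelling all diagrams with the two permutations interchanged is an
  isomorphism of the variants, because the middle factor in \<open>\<xi>\<alpha>\<eta>\<close> meets its neighbours in renamed
  points (\<open>same_parameters_relabel\<close>, \<open>relabel_variant_iso\<close>).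

  For the converse, the cardinality of the variant gives \<open>n\<close>, since larger sets have more matchings.
  The other parameters come from the equivalence \<open>\<xi>\<alpha> = \<xi>'\<alpha>\<close> on diagrams. It is visible in
  the variant: it holds iff \<open>\<xi> \<star> \<eta> = \<xi>' \<star> \<eta>\<close> for all \<open>\<eta>\<close> (take the identity for \<open>\<eta>\<close>). To compute
  \<open>\<xi>\<alpha>\<close>, one closes up the lower vertices of \<open>\<xi>\<close> with the upper hooks of \<open>\<alpha>\<close>, forgets the lower
  vertices that face upper singletons of \<open>\<alpha>\<close>, and is left with a matching on \<open>n + r\<close> vertices: the
  upper ones and those that face transversals (\<open>product_edges_eq\<close>). This contraction has every
  matching of the \<open>n + r\<close> vertices as a value, so the number of equivalence classes determines \<open>r\<close>.

  The sizes of the classes determine the number of upper hooks of \<open>\<alpha>\<close>, hence \<open>k\<close>. The class with the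
  empty contraction is the largest one (\<open>card_fibre_le\<close>): an edge of the contraction is realised by a
  path in the union, and cutting the first edge of that path can be undone. The size of this largest
  class strictly decreases when two upper singleton blocks are joined to a hook, as hooks only add
  connections (\<open>card_empty_fibre_less\<close>). The strictness needs two vertices among the \<open>n + r\<close> that
  the new hook can connect; there are two because \<open>r \<ge> 1\<close>.

  Turning diagrams upside down reverses products and, by associativity, carries an isomorphism of
  variants to one of the flipped variants; so \<open>p\<close> is determined as well.
\<close>

section \<open>Matchings\<close>

definition matchings :: "'a set \<Rightarrow> 'a rel set" where
  "matchings X = {M. M \<subseteq> X \<times> X \<and> sym M \<and> irrefl M \<and> single_valued M}"

lemma matchingsI:
  assumes "\<And>x y. (x, y) \<in> M \<Longrightarrow> x \<in> X" "\<And>x y. (x, y) \<in> M \<Longrightarrow> (y, x) \<in> M"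
    "\<And>x. (x, x) \<notin> M" "\<And>x y z. (x, y) \<in> M \<Longrightarrow> (x, z) \<in> M \<Longrightarrow> y = z"
  shows "M \<in> matchings X"
  using assms unfolding matchings_def sym_def irrefl_def single_valued_def by auto

lemma matchingsD:
  assumes "M \<in> matchings X"
  shows "(x, y) \<in> M \<Longrightarrow> x \<in> X" "(x, y) \<in> M \<Longrightarrow> y \<in> X" "(x, y) \<in> M \<Longrightarrow> (y, x) \<in> M"
    "(x, x) \<notin> M" "(x, y) \<in> M \<Longrightarrow> (x, z) \<in> M \<Longrightarrow> y = z"
  using assms unfolding matchings_def sym_def irrefl_def single_valued_def by auto

lemma finite_matchings: "finite X \<Longrightarrow> finite (matchings X)"
  by (rule finite_subset[of _ "Pow (X \<times> X)"]) (auto simp: matchings_def)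

lemma finite_matching: "M \<in> matchings X \<Longrightarrow> finite X \<Longrightarrow> finite M"
  unfolding matchings_def by (auto intro: finite_subset[of _ "X \<times> X"])

lemma matchings_mono: "X \<subseteq> Y \<Longrightarrow> matchings X \<subseteq> matchings Y"
  by (auto simp: matchings_def)

lemma empty_matching: "{} \<in> matchings X"
  by (auto simp: matchings_def sym_def irrefl_def)

lemma matchings_union:
  assumes M: "M \<in> matchings Y" and N: "N \<in> matchings (X - Y)" and Y: "Y \<subseteq> X"
  shows "M \<union> N \<in> matchings X"
proof (rule matchingsI)
  show "x \<in> X" if "(x, y) \<in> M \<union> N" for x y
    using that matchingsD(1)[OF M] matchingsD(1)[OF N] Y by auto
  show "(y, x) \<in> M \<union> N" if "(x, y) \<in> M \<union> N" for x y
    using that matchingsD(3)[OF M] matchingsD(3)[OF N] by auto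
  show "(x, x) \<notin> M \<union> N" for x
    using matchingsD(4)[OF M] matchingsD(4)[OF N] by auto
  show "y = z" if "(x, y) \<in> M \<union> N" "(x, z) \<in> M \<union> N" for x y z
    using that matchingsD(1)[OF M] matchingsD(1)[OF N] matchingsD(5)[OF M] matchingsD(5)[OF N] by blast
qed

lemma map_matching:
  assumes M: "M \<in> matchings X" and f: "inj_on f X" "f ` X \<subseteq> Y"
  shows "map_prod f f ` M \<in> matchings Y"
proof (rule matchingsI)
  show "x \<in> Y" if "(x, y) \<in> map_prod f f ` M" for x y
    using that f(2) matchingsD(1)[OF M] by auto
  show "(y, x) \<in> map_prod f f ` M" if "(x, y) \<in> map_prod f f ` M" for x y
    using that matchingsD(3)[OF M] by force
  show "(x, x) \<notin> map_prod f f ` M" for x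
  proof
    assume "(x, x) \<in> map_prod f f ` M"
    then obtain a b where "(a, b) \<in> M" "f a = f b" by auto
    then show False using matchingsD[OF M] f(1) by (metis inj_onD)
  qed
  show "y = z" if y: "(x, y) \<in> map_prod f f ` M" and z: "(x, z) \<in> map_prod f f ` M" for x y z
  proof -
    obtain a b c d where "(a, b) \<in> M" "(c, d) \<in> M" "f a = f c" "y = f b" "z = f d"
      using y z by auto
    then show ?thesis using matchingsD[OF M] f(1) by (metis inj_onD)
  qed
qed

text \<open>
  Two matchings are two involutions, which fix the unmatched points. The component of an end \<open>x\<close>
  is traversed by the walk from \<open>x\<close> that applies the two involutions alternately. At the first end
  after \<open>x\<close> the walk turns round, so it sees no vertex later than that. Two further ends would
  therefore both be visited before the other.
\<close>

lemma three_ends_in_involution_orbit: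
  assumes ff: "\<And>v. f (f v) = v" and gg: "\<And>v. g (g v) = v" and gx: "g x = x"
    and y: "f y = y \<or> g y = y" and z: "f z = z \<or> g z = z"
    and xy: "(x, y) \<in> {(u, v). v = f u \<or> v = g u}\<^sup>*" 
    and xz: "(x, z) \<in> {(u, v). v = f u \<or> v = g u}\<^sup>*" 
    and neq: "x \<noteq> y" "x \<noteq> z"
  shows "y = z"
proof -
  define R where "R = {(u, v). v = f u \<or> v = g u}"
  define s where "s i = (if even i then f else g)" for i :: nat
  define w where "w = rec_nat x (\<lambda>i v. s i v)"
  have w0: "w 0 = x" and wS: "w (Suc i) = s i (w i)" for i by (simp_all add: w_def)
  have previous: "s (Suc i) (w i) = (if i = 0 then x else w (i - 1))" for i
    by (cases i) (auto simp: w0 wS gx s_def ff gg)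
  have nbr: "(w i, v) \<in> R \<longleftrightarrow> v = w (Suc i) \<or> v = (if i = 0 then x else w (i - 1))" for i v
    unfolding previous[symmetric] wS by (auto simp: R_def s_def)
  \<comment> \<open>a fixed end cuts the walk: everything reachable is met before its first visit\<close>
  have cut: "\<exists>i\<le>(LEAST i. e = w i). v = w i"
    if e: "f e = e \<or> g e = e" "(x, e) \<in> R\<^sup>*" "x \<noteq> e" and v: "(x, v) \<in> R\<^sup>*" for e v
  proof -
    have "\<exists>i. u = w i" if "(x, u) \<in> R\<^sup>*" for u
      using that
    proof (induction rule: rtrancl_induct)
      case base show ?case using w0 by (intro exI[of _ 0]) simp
    next
      case (step b c)
      then obtain i where "b = w i" by blast
      with step(2) nbr have "c = w (Suc i) \<or> c = w (if i = 0 then 0 else i - 1)"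
        by (auto simp: w0)
      then show ?case by blast
    qed
    then have ex: "\<exists>i. e = w i" using e(2) by blast
    define k where "k = (LEAST i. e = w i)"
    have k: "e = w k" unfolding k_def using ex by (rule LeastI_ex)
    have k0: "k > 0" using k w0 e(3) by (cases k) auto
    \<comment> \<open>at its first visit, an end cannot be fixed by the involution that led to it\<close>
    have "e \<noteq> w (k - 1)" using not_less_Least[of "k - 1" "\<lambda>i. e = w i"] k0 by (auto simp: k_def)
    then have "s (Suc k) e \<noteq> e" using previous[of k] k k0 by auto
    then have "s k e = e" using e(1) by (auto simp: s_def split: if_splits)
    then have Sk: "w (Suc k) = w k" using k wS by simp
    have "\<exists>i\<le>k. u = w i" if "(x, u) \<in> R\<^sup>*" for u
      using that
    proof (induction rule: rtrancl_induct)
      case base show ?case using w0 by (intro exI[of _ 0]) simp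
    next
      case (step b c)
      then obtain i where i: "i \<le> k" "b = w i" by blast
      with step(2) nbr have "c = w (if i = k then k else Suc i) \<or> c = w (if i = 0 then 0 else i - 1)"
        using Sk w0 by auto
      moreover have "(if i = k then k else Suc i) \<le> k" "(if i = 0 then 0 else i - 1) \<le> k"
        using i(1) by auto
      ultimately show ?case by blast
    qed
    then show ?thesis using v k_def by blast
  qed
  have le: "(LEAST i. b = w i) \<le> (LEAST i. a = w i)"
    if ab: "f a = a \<or> g a = a" "(x, a) \<in> R\<^sup>*" "x \<noteq> a" "(x, b) \<in> R\<^sup>*" for a b
  proof -
    obtain i where i: "i \<le> (LEAST i. a = w i)" "b = w i" using cut[OF ab] by blast
    have "(LEAST i. b = w i) \<le> i" using i(2) by (rule Least_le)
    then show ?thesis using i(1) by simp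
  qed
  have xyz: "(x, y) \<in> R\<^sup>*" "(x, z) \<in> R\<^sup>*" using xy xz by (simp_all add: R_def)
  have "(LEAST i. y = w i) = (LEAST i. z = w i)"
    using le[OF y xyz(1) neq(1) xyz(2)] le[OF z xyz(2) neq(2) xyz(1)] by simp
  moreover have "y = w (LEAST i. y = w i)" 
    using cut[OF y xyz(1) neq(1) xyz(1)] by (metis (mono_tags, lifting) LeastI)
  moreover have "z = w (LEAST i. z = w i)"
    using cut[OF z xyz(2) neq(2) xyz(2)] by (metis (mono_tags, lifting) LeastI)
  ultimately show ?thesis by simp
qed

definition partner :: "'a rel \<Rightarrow> 'a \<Rightarrow> 'a" where
  "partner M x = (if x \<in> Domain M then THE y. (x, y) \<in> M else x)"

lemma partner_eq: "M \<in> matchings X \<Longrightarrow> (x, y) \<in> M \<Longrightarrow> partner M x = y"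
  unfolding partner_def using matchingsD(5) by fastforce

lemma partner_involution:
  assumes "M \<in> matchings X" shows "partner M (partner M x) = x"
proof (cases "x \<in> Domain M")
  case True
  then show ?thesis using assms partner_eq matchingsD(3) by (metis DomainE)
qed (simp add: partner_def)

lemma three_ends_not_connected:
  assumes M: "M \<in> matchings V" and H: "H \<in> matchings V"
    and "x \<notin> Domain M \<or> x \<notin> Domain H" "y \<notin> Domain M \<or> y \<notin> Domain H" "z \<notin> Domain M \<or> z \<notin> Domain H"
    and "(x, y) \<in> (M \<union> H)\<^sup>*" "(x, z) \<in> (M \<union> H)\<^sup>*" "x \<noteq> y" "x \<noteq> z"
  shows "y = z"
proof -
  let ?f = "partner M" and ?g = "partner H"
  let ?R = "{(u, v). v = ?f u \<or> v = ?g u}"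
  have sub: "(M \<union> H)\<^sup>* \<subseteq> ?R\<^sup>*"
    by (intro rtrancl_mono) (auto dest: partner_eq[OF M] partner_eq[OF H])
  have xy: "(x, y) \<in> ?R\<^sup>*" and xz: "(x, z) \<in> ?R\<^sup>*" using sub assms(6,7) by auto
  have fixed: "v \<notin> Domain M \<or> v \<notin> Domain H \<Longrightarrow> ?f v = v \<or> ?g v = v" for v
    by (auto simp: partner_def)
  note ends = fixed[OF assms(4)] fixed[OF assms(5)]
  have swap: "?R = {(u, v). v = ?g u \<or> v = ?f u}" by auto
  from fixed[OF assms(3)] show ?thesis
  proof
    assume "?g x = x"
    then show ?thesis
      using three_ends_in_involution_orbit[of ?f ?g x y z] ends xy xz assms(8,9)
        partner_involution[OF M] partner_involution[OF H] by blast
  next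
    assume "?f x = x"
    then show ?thesis
      using three_ends_in_involution_orbit[of ?g ?f x y z] ends xy xz assms(8,9) 
        partner_involution[OF M] partner_involution[OF H] unfolding swap by blast
  qed
qed

section \<open>Contraction of a matching along another\<close>

text \<open>
  The boundary \<open>X\<close> will be disjoint from the field of \<open>H\<close>, so every point of \<open>X\<close> is an end of a path
  of \<open>M \<union> H\<close>. Points outside \<open>X\<close> that \<open>H\<close> leaves unmatched are simply forgotten.
\<close>

definition contraction :: "'a set \<Rightarrow> 'a rel \<Rightarrow> 'a rel \<Rightarrow> 'a rel" where
  "contraction X H M = {(x, y). x \<in> X \<and> y \<in> X \<and> x \<noteq> y \<and> (x, y) \<in> (M \<union> H)\<^sup>*}"

lemma closed_rtrancl:
  assumes "(x, y) \<in> R\<^sup>*" "x \<in> K" "\<And>u v. u \<in> K \<Longrightarrow> (u, v) \<in> R \<Longrightarrow> v \<in> K"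
  shows "y \<in> K"
  using assms(1,2) by (induction rule: rtrancl_induct) (use assms(3) in auto)

lemma sym_matching_union_rtrancl:
  "M \<in> matchings V \<Longrightarrow> H \<in> matchings W \<Longrightarrow> sym ((M \<union> H)\<^sup>*)"
  by (intro sym_rtrancl sym_Un) (auto simp: matchings_def)

text \<open>
  Three connected points of \<open>X\<close> would be three ends of one path.
\<close>

lemma contraction_matching:
  assumes M: "M \<in> matchings V" and H: "H \<in> matchings (V - X)"
  shows "contraction X H M \<in> matchings X"
proof (rule matchingsI)
  have H': "H \<in> matchings V" using H matchings_mono[of "V - X" V] by auto
  have X: "x \<notin> Domain H" if "x \<in> X" for x using that matchingsD(1)[OF H] by blast
  show "(y, x) \<in> contraction X H M" if "(x, y) \<in> contraction X H M" for x y
    using that symD[OF sym_matching_union_rtrancl[OF M H]] by (auto simp: contraction_def)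
  show "y = z" if "(x, y) \<in> contraction X H M" "(x, z) \<in> contraction X H M" for x y z
    using that three_ends_not_connected[OF M H', of x y z] X by (auto simp: contraction_def)
qed (auto simp: contraction_def)

lemma contraction_of_matching:
  assumes M: "M \<in> matchings X" and H: "H \<in> matchings (V - X)"
  shows "contraction X H M = M"
proof -
  have "y = x \<or> (x, y) \<in> M" if "(x, y) \<in> (M \<union> H)\<^sup>*" "x \<in> X" for x y
    using closed_rtrancl[OF that(1), of "{y. y = x \<or> (x, y) \<in> M}"] that(2)
      matchingsD[OF M] matchingsD[OF H] by (auto, blast+)
  then show ?thesis
    using matchingsD[OF M] by (auto simp: contraction_def)
qed

text \<open>
  Surjectivity holds because a matching of \<open>X\<close> is its own contraction.
\<close>

lemma contraction_image:
  assumes "X \<subseteq> V" "H \<in> matchings (V - X)"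
  shows "contraction X H ` matchings V = matchings X"
proof
  show "contraction X H ` matchings V \<subseteq> matchings X"
    using contraction_matching[OF _ assms(2)] by auto
  show "matchings X \<subseteq> contraction X H ` matchings V"
    using contraction_of_matching[OF _ assms(2)] matchings_mono[OF assms(1)] by (metis image_iff subsetI subset_iff)
qed

section \<open>The largest fibre of a contraction\<close>

definition fibre :: "'a set \<Rightarrow> 'a set \<Rightarrow> 'a rel \<Rightarrow> 'a rel \<Rightarrow> 'a rel set" where
  "fibre V X H \<gamma> = {M \<in> matchings V. contraction X H M = \<gamma>}"

lemma finite_fibre: "finite V \<Longrightarrow> finite (fibre V X H \<gamma>)"
  by (simp add: fibre_def finite_matchings)

definition isolate :: "'a \<Rightarrow> 'a rel \<Rightarrow> 'a rel" where
  "isolate x M = {(a, b) \<in> M. a \<noteq> x \<and> b \<noteq> x}"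

lemma isolate_matching: "M \<in> matchings V \<Longrightarrow> isolate x M \<in> matchings V"
  by (rule matchingsI) (auto simp: isolate_def dest: matchingsD)

lemma isolate_partner:
  assumes "M \<in> matchings V" "(x, z) \<in> M"
  shows "M = isolate x M \<union> {(x, z), (z, x)}"
  using assms matchingsD[OF assms(1)] unfolding isolate_def by fast

text \<open>
  Since \<open>x\<close> is an end of its path, removing its edge isolates \<open>x\<close> and changes no connection between
  other vertices. Thus exactly the edge at \<open>x\<close> disappears from the contraction.
\<close>

lemma isolate_fibre:
  assumes M: "M \<in> fibre V X H \<gamma>" and H: "H \<in> matchings (V - X)" and xy: "(x, y) \<in> \<gamma>"
  shows "isolate x M \<in> fibre V X H (\<gamma> - {(x, y), (y, x)})"
proof -
  have MV: "M \<in> matchings V" and \<gamma>: "contraction X H M = \<gamma>" using M by (auto simp: fibre_def)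
  have \<gamma>m: "\<gamma> \<in> matchings X" using contraction_matching[OF MV H] \<gamma> by simp
  have xX: "x \<in> X" using matchingsD(1)[OF \<gamma>m xy] .
  have xH: "(x, b) \<notin> H" "(b, x) \<notin> H" for b using matchingsD[OF H] xX by blast+
  let ?G = "isolate x M \<union> H"
  have sub: "?G\<^sup>* \<subseteq> (M \<union> H)\<^sup>*" by (intro rtrancl_mono) (auto simp: isolate_def)
  have iso: "a = x" if "(x, a) \<in> ?G\<^sup>*" for a
    using closed_rtrancl[OF that, of "{x}"] xH by (auto simp: isolate_def)
  have iso': "a = x" if "(a, x) \<in> ?G\<^sup>*" for a
    using iso symD[OF sym_matching_union_rtrancl[OF isolate_matching[OF MV] H] that] by auto
  have "contraction X H (isolate x M) = \<gamma> - {(x, y), (y, x)}"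
  proof (intro equalityI subrelI)
    fix a b assume ab: "(a, b) \<in> contraction X H (isolate x M)"
    then have "(a, b) \<in> \<gamma>" using sub \<gamma> by (auto simp: contraction_def)
    moreover have "a \<noteq> x" "b \<noteq> x" using ab iso iso' by (auto simp: contraction_def)
    ultimately show "(a, b) \<in> \<gamma> - {(x, y), (y, x)}" by auto
  next
    fix a b assume ab: "(a, b) \<in> \<gamma> - {(x, y), (y, x)}"
    then have ax: "a \<noteq> x" using matchingsD(5)[OF \<gamma>m xy, of b] by auto
    have aX: "a \<in> X" "b \<in> X" "a \<noteq> b" using ab matchingsD[OF \<gamma>m] by auto
    have nx: "(a, x) \<notin> (M \<union> H)\<^sup>*"
    proof
      assume "(a, x) \<in> (M \<union> H)\<^sup>*"
      then have "(a, x) \<in> \<gamma>" using aX ax xX \<gamma> by (auto simp: contraction_def)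
      then have "a = y" using matchingsD(3,5)[OF \<gamma>m] xy by blast
      then show False using ab matchingsD(3,5)[OF \<gamma>m] xy by blast
    qed
    have "(a, b) \<in> (M \<union> H)\<^sup>*" using ab \<gamma> by (auto simp: contraction_def)
    then have "(a, b) \<in> ?G\<^sup>*"
    proof (induction rule: rtrancl_induct)
      case (step c d)
      have "c \<noteq> x" "d \<noteq> x" using step(1,2) nx by (auto intro: rtrancl.rtrancl_into_rtrancl)
      then have "(c, d) \<in> ?G" using step(2) by (auto simp: isolate_def)
      then show ?case using step(3) by (rule rtrancl.rtrancl_into_rtrancl[rotated])
    qed simp
    then show "(a, b) \<in> contraction X H (isolate x M)"
      using aX by (auto simp: contraction_def)
  qed
  then show ?thesis using isolate_matching[OF MV] by (auto simp: fibre_def)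
qed

text \<open>
  The removed edge can be recovered from \<open>y\<close>: the rest of the path from \<open>x\<close> to \<open>y\<close> starts at the
  former partner of \<open>x\<close>, which is therefore the other end of the path of \<open>y\<close> after the removal.
\<close>

lemma inj_on_isolate_fibre:
  assumes H: "H \<in> matchings (V - X)" and xy: "(x, y) \<in> \<gamma>"
  shows "inj_on (isolate x) (fibre V X H \<gamma>)"
proof (rule inj_onI)
  fix M N assume MN: "M \<in> fibre V X H \<gamma>" "N \<in> fibre V X H \<gamma>" and eq: "isolate x M = isolate x N"
  let ?G = "isolate x M \<union> H"
  have H': "H \<in> matchings V" using H matchings_mono[of "V - X" V] by auto
  have key: "\<exists>z. (x, z) \<in> L \<and> (y, z) \<in> ?G\<^sup>* \<and> z \<notin> Domain (isolate x M)"
    if L: "L \<in> fibre V X H \<gamma>" "isolate x L = isolate x M" for L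
  proof -
    have LV: "L \<in> matchings V" and \<gamma>: "contraction X H L = \<gamma>" using L by (auto simp: fibre_def)
    have con: "x \<in> X" "x \<noteq> y" "(x, y) \<in> (L \<union> H)\<^sup>*" using xy \<gamma> by (auto simp: contraction_def)
    have xH: "(x, b) \<notin> H" for b using matchingsD[OF H] con(1) by blast
    obtain z where z: "(x, z) \<in> L" using con xH by (metis UnE converse_rtranclE)
    have "y \<in> {c. c = x \<or> (z, c) \<in> ?G\<^sup>*}"
    proof (rule closed_rtrancl[OF con(3)])
      fix c d assume c: "c \<in> {c. c = x \<or> (z, c) \<in> ?G\<^sup>*}" and cd: "(c, d) \<in> L \<union> H"
      show "d \<in> {c. c = x \<or> (z, c) \<in> ?G\<^sup>*}"
      proof (cases "c = x")
        case True
        then have "d = z" using cd xH matchingsD(5)[OF LV z] by auto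
        then show ?thesis by simp
      next
        case False
        then have "d = x \<or> (c, d) \<in> ?G" using cd L(2) by (auto simp: isolate_def)
        then show ?thesis using c False by (auto intro: rtrancl.rtrancl_into_rtrancl)
      qed
    qed simp
    then have "(y, z) \<in> ?G\<^sup>*"
      using con(2) symD[OF sym_matching_union_rtrancl[OF isolate_matching[OF LV, of x] H], of z y] L(2)
      by auto
    moreover have "z \<notin> Domain (isolate x L)"
      using matchingsD(3,5)[OF LV] z unfolding isolate_def by blast
    ultimately show ?thesis using z L(2) by auto
  qed
  have MV: "M \<in> matchings V" and NV: "N \<in> matchings V" using MN by (auto simp: fibre_def)
  obtain u where u: "(x, u) \<in> M" "(y, u) \<in> ?G\<^sup>*" "u \<notin> Domain (isolate x M)"
    using key[OF MN(1)] by blast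
  obtain v where v: "(x, v) \<in> N" "(y, v) \<in> ?G\<^sup>*" "v \<notin> Domain (isolate x M)"
    using key[OF MN(2)] eq by auto
  have "y \<in> X" using xy MN(1) by (auto simp: fibre_def contraction_def)
  then have yH: "y \<notin> Domain H" using matchingsD(1)[OF H] by blast
  have "u = v"
  proof (cases "y \<in> Domain (isolate x M)")
    case True
    then show ?thesis
      using three_ends_not_connected[OF isolate_matching[OF MV, of x] H', of y u v] u v yH by auto
  next
    case False
    have "b = y" if "(y, b) \<in> ?G\<^sup>*" for b
      using closed_rtrancl[OF that, of "{y}"] False yH by auto
    then show ?thesis using u v by metis
  qed
  then show "M = N" using isolate_partner[OF MV u(1)] isolate_partner[OF NV v(1)] eq by simp
qed

text \<open>
  Repeated removal of edges from \<open>\<gamma>\<close>, each by the injection above.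
\<close>

lemma card_fibre_le:
  assumes V: "finite V" and H: "H \<in> matchings (V - X)" and \<gamma>: "finite \<gamma>" "fibre V X H \<gamma> \<noteq> {}"
  shows "card (fibre V X H \<gamma>) \<le> card (fibre V X H {})"
  using \<gamma>
proof (induction "card \<gamma>" arbitrary: \<gamma> rule: less_induct)
  case less
  show ?case
  proof (cases "\<gamma> = {}")
    case False
    then obtain x y where xy: "(x, y) \<in> \<gamma>" by auto
    let ?\<delta> = "\<gamma> - {(x, y), (y, x)}"
    have sub: "isolate x ` fibre V X H \<gamma> \<subseteq> fibre V X H ?\<delta>"
      using isolate_fibre[OF _ H xy] by blast
    have "card (fibre V X H \<gamma>) \<le> card (fibre V X H ?\<delta>)"
      using card_inj_on_le[OF inj_on_isolate_fibre[OF H xy] sub finite_fibre[OF V]] .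
    also have "\<dots> \<le> card (fibre V X H {})"
    proof (rule less.hyps)
      show "card ?\<delta> < card \<gamma>" using xy less.prems(1) by (intro psubset_card_mono) auto
    qed (use sub less.prems in auto)
    finally show ?thesis .
  qed simp
qed

text \<open>
  A larger \<open>H\<close> connects more, so fewer matchings contract to nothing. If \<open>H'\<close> has an additional edge
  \<open>ab\<close>, the matching with edges \<open>xa\<close> and \<open>yb\<close> becomes a path from \<open>x\<close> to \<open>y\<close> with \<open>H'\<close>, and
  contracts to nothing with \<open>H\<close>.
\<close>

lemma card_empty_fibre_strict:
  assumes V: "finite V" "X \<subseteq> V" and H: "H' \<in> matchings (V - X)" "H \<subset> H'" "H \<in> matchings (V - X)"
    and xy: "x \<in> X" "y \<in> X" "x \<noteq> y"
  shows "card (fibre V X H' {}) < card (fibre V X H {})"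
proof (rule psubset_card_mono[OF finite_fibre[OF V(1)]])
  have "(M \<union> H)\<^sup>* \<subseteq> (M \<union> H')\<^sup>*" for M using H(2) by (intro rtrancl_mono) auto
  then have sub: "fibre V X H' {} \<subseteq> fibre V X H {}"
    unfolding fibre_def contraction_def by blast
  obtain a b where ab: "(a, b) \<in> H'" "(a, b) \<notin> H" using H(2) by auto
  have abV: "a \<in> V - X" "b \<in> V - X" "a \<noteq> b" using ab matchingsD[OF H(1)] by blast+
  have aH: "(a, c) \<notin> H" "(c, a) \<notin> H" "(b, c) \<notin> H" "(c, b) \<notin> H" for c
    using ab H(2) matchingsD[OF H(1)] matchingsD[OF H(3)] by blast+
  have XH: "(c, d) \<notin> H" if "c \<in> X" for c d using that matchingsD[OF H(3)] by blast
  let ?M = "{(x, a), (a, x), (y, b), (b, y)}"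
  have M: "?M \<in> matchings V"
    by (rule matchingsI) (use abV xy V(2) in auto)
  have "(x, y) \<in> (?M \<union> H')\<^sup>*"
    by (rule rtrancl_trans[of _ a], blast, rule rtrancl_trans[of _ b], use ab(1) in blast, blast)
  then have "?M \<notin> fibre V X H' {}" using xy by (auto simp: fibre_def contraction_def)
  moreover have "?M \<in> fibre V X H {}"
  proof -
    have "c = d" if cX: "c \<in> X" and dX: "d \<in> X" and con: "(c, d) \<in> (?M \<union> H)\<^sup>*" for c d
    proof -
      consider "c = x" | "c = y" | "c \<noteq> x" "c \<noteq> y" by blast
      then show ?thesis
      proof cases
        case 1
        have "d \<in> {x, a}" by (rule closed_rtrancl[OF con]) (use 1 xy abV aH XH in auto)
        then show ?thesis using 1 dX abV by auto
      next
        case 2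
        have "d \<in> {y, b}" by (rule closed_rtrancl[OF con]) (use 2 xy abV aH XH in auto)
        then show ?thesis using 2 dX abV by auto
      next
        case 3
        have "d \<in> {c}" by (rule closed_rtrancl[OF con]) (use 3 cX abV XH in auto)
        then show ?thesis by simp
      qed
    qed
    then have "contraction X H ?M = {}" unfolding contraction_def by blast
    then show ?thesis using M by (simp add: fibre_def)
  qed
  ultimately show "fibre V X H' {} \<subset> fibre V X H {}" using sub by blast
qed

section \<open>What the kernel of a contraction determines\<close>

lemma extend_injection_to_bijection:
  assumes AB: "finite A" "finite B" "card A = card B"
    and f: "D \<subseteq> A" "inj_on f D" "f ` D \<subseteq> B"
  shows "\<exists>g. bij_betw g A B \<and> (\<forall>x\<in>D. g x = f x)"
proof -
  have "card (A - D) = card (B - f ` D)"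
    using AB f by (simp add: card_Diff_subset finite_subset[OF f(1)] card_image)
  then obtain h where h: "bij_betw h (A - D) (B - f ` D)"
    using AB finite_same_card_bij[of "A - D" "B - f ` D"] by auto
  let ?g = "\<lambda>x. if x \<in> D then f x else h x"
  have "bij_betw ?g D (f ` D)" using f(2) by (auto simp: bij_betw_def inj_on_def)
  moreover have "bij_betw ?g (A - D) (B - f ` D)"
    using h by (subst bij_betw_cong[of _ _ h]) auto
  ultimately have "bij_betw ?g (D \<union> (A - D)) (f ` D \<union> (B - f ` D))"
    by (rule bij_betw_combine) auto
  moreover have "D \<union> (A - D) = A" "f ` D \<union> (B - f ` D) = B" using f by auto
  ultimately show ?thesis by (intro exI[of _ ?g]) auto
qed

lemma isolate_subset: "isolate x M \<subseteq> M"
  by (auto simp: isolate_def)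

lemma card_isolate:
  assumes M: "M \<in> matchings X" "finite M" "(x, y) \<in> M"
  shows "card M = card (isolate x M) + 2"
proof -
  have "card M = card (isolate x M \<union> {(x, y), (y, x)})"
    using isolate_partner[OF M(1,3)] by simp
  also have "\<dots> = card (isolate x M) + card {(x, y), (y, x)}"
    by (rule card_Un_disjoint)
      (auto simp: isolate_def intro: finite_subset[OF isolate_subset M(2), unfolded isolate_def])
  also have "card {(x, y), (y, x)} = 2"
  proof -
    have "x \<noteq> y" using matchingsD(4)[OF M(1)] M(3) by auto
    then show ?thesis by simp
  qed
  finally show ?thesis .
qed

text \<open>
  Induction on the number of edges: remove an edge from each matching, and send the ends of the one
  to the ends of the other.
\<close>

lemma embed_matching:
  assumes "finite M" "finite N" "M \<in> matchings X" "N \<in> matchings Y" "card M \<le> card N"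
  shows "\<exists>f. inj_on f (Domain M) \<and> map_prod f f ` M \<subseteq> N"
  using assms
proof (induction "card M" arbitrary: M N rule: less_induct)
  case less
  show ?case
  proof (cases "M = {}")
    case False
    then obtain x y where xy: "(x, y) \<in> M" by auto
    have "N \<noteq> {}" using less.prems False by auto
    then obtain u v where uv: "(u, v) \<in> N" by auto
    let ?M = "isolate x M" and ?N = "isolate u N"
    have fin: "finite ?M" "finite ?N"
      using less.prems(1,2) by (auto intro: finite_subset[OF isolate_subset])
    have "card ?M < card M" "card ?M \<le> card ?N"
      using card_isolate[OF less.prems(3,1) xy] card_isolate[OF less.prems(4,2) uv] less.prems(5)
      by linarith+
    then obtain f where f: "inj_on f (Domain ?M)" "map_prod f f ` ?M \<subseteq> ?N"
      using less.hyps[of ?M ?N, OF _ fin isolate_matching[OF less.prems(3)] isolate_matching[OF less.prems(4)]]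
      by blast
    define h where "h = f(x := u, y := v)"
    have x: "x \<notin> Domain ?M" and y: "y \<notin> Domain ?M"
      using matchingsD[OF less.prems(3)] xy unfolding isolate_def by blast+
    have u: "u \<notin> Domain ?N" and v: "v \<notin> Domain ?N"
      using matchingsD[OF less.prems(4)] uv unfolding isolate_def by blast+
    have neq: "x \<noteq> y" "u \<noteq> v" using matchingsD(4)[OF less.prems(3)] matchingsD(4)[OF less.prems(4)] xy uv by auto
    have fD: "f a \<in> Domain ?N" if "a \<in> Domain ?M" for a using that f(2) by auto
    have hxy: "h x = u" "h y = v" using neq by (auto simp: h_def)
    have eq: "h a = f a" if "a \<in> Domain ?M" for a using that x y by (auto simp: h_def)
    have inj: "inj_on h (Domain ?M)" using f(1) eq by (simp add: inj_on_def)
    have img: "h ` Domain ?M \<subseteq> Domain ?N" using fD eq by auto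
    have DM: "Domain M = insert x (insert y (Domain ?M))"
      using isolate_partner[OF less.prems(3) xy] by blast
    have "inj_on h (Domain M)"
    proof -
      have "u \<notin> h ` Domain ?M" "v \<notin> h ` Domain ?M" using img u v by blast+
      then show ?thesis unfolding DM using inj neq(2) by (auto simp: hxy)
    qed
    moreover have "map_prod h h ` M \<subseteq> N"
    proof
      fix e assume "e \<in> map_prod h h ` M"
      then obtain a b where ab: "(a, b) \<in> M" "e = (h a, h b)" by auto
      then consider "(a, b) \<in> ?M" | "(a, b) = (x, y)" | "(a, b) = (y, x)"
        using isolate_partner[OF less.prems(3) xy] by blast
      then show "e \<in> N"
      proof cases
        case 1
        then have "b \<in> Domain ?M" "a \<in> Domain ?M"
          using matchingsD(3)[OF isolate_matching[OF less.prems(3)]] by blast+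
        then have "e = map_prod f f (a, b)" using ab(2) eq by simp
        then show ?thesis using 1 f(2) isolate_subset[of u N] by blast
      qed (use ab hxy uv matchingsD(3)[OF less.prems(4)] in auto)
    qed
    ultimately show ?thesis by blast
  qed simp
qed

text \<open>
  An injection that misses \<open>a\<close> transports matchings injectively, and a matching with an edge at \<open>a\<close> is
  not reached. Such an edge needs a second point, hence the assumption that the smaller set is nonempty
  (the empty set and a singleton have one matching each).
\<close>

lemma card_matchings_strict:
  assumes "finite Y" "0 < card X" "card X < card Y"
  shows "card (matchings X) < card (matchings Y)"
proof -
  have X: "finite X" using assms(2) card_gt_0_iff by blast
  obtain f where f: "inj_on f X" "f ` X \<subseteq> Y"
    using card_le_inj[OF X assms(1)] assms(3) by auto
  let ?F = "(`) (map_prod f f)"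
  have "inj_on ?F (matchings X)"
  proof (rule inj_on_subset)
    show "inj_on ?F (Pow (X \<times> X))"
      using f(1) by (intro inj_on_image_Pow map_prod_inj_on) auto
  qed (auto simp: matchings_def)
  then have "card (matchings X) = card (?F ` matchings X)" by (simp add: card_image)
  also have "\<dots> < card (matchings Y)"
  proof (rule psubset_card_mono[OF finite_matchings[OF assms(1)]])
    have "card (f ` X) < card Y" using f(1) assms(3) by (simp add: card_image)
    then obtain a where a: "a \<in> Y" "a \<notin> f ` X" using f(2)
      by (metis less_irrefl subsetI subset_antisym)
    obtain b where b: "b \<in> f ` X" using assms(2) by fastforce
    have "{(a, b), (b, a)} \<in> matchings Y"
      by (rule matchingsI) (use a b f(2) in auto)
    moreover have "{(a, b), (b, a)} \<notin> ?F ` matchings X"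
    proof
      assume "{(a, b), (b, a)} \<in> ?F ` matchings X"
      then obtain M where M: "M \<in> matchings X" "{(a, b), (b, a)} = map_prod f f ` M" by auto
      have "(a, b) \<in> map_prod f f ` M" using M(2) by blast
      with M(1) show False using a(2) matchingsD(1) by fastforce
    qed
    moreover have "?F ` matchings X \<subseteq> matchings Y" using map_matching[OF _ f] by blast
    ultimately show "?F ` matchings X \<subset> matchings Y" by blast
  qed
  finally show ?thesis .
qed

lemma card_empty_fibre_transport:
  assumes V: "finite W" and g: "inj_on g V" "g ` V \<subseteq> W"
    and H: "H \<in> matchings (V - X)" and X: "X \<subseteq> V"
  shows "card (fibre V X H {}) \<le> card (fibre W (g ` X) (map_prod g g ` H) {})"
proof (rule card_inj_on_le[OF _ _ finite_fibre[OF V]])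
  let ?F = "(`) (map_prod g g)"
  have "inj_on ?F (Pow (V \<times> V))"
    using g(1) by (intro inj_on_image_Pow map_prod_inj_on) auto
  then show "inj_on ?F (fibre V X H {})"
    by (rule inj_on_subset) (auto simp: fibre_def matchings_def)
  show "?F ` fibre V X H {} \<subseteq> fibre W (g ` X) (?F H) {}"
  proof
    fix N assume "N \<in> ?F ` fibre V X H {}"
    then obtain M where N: "N = ?F M" and M: "M \<in> matchings V" "contraction X H M = {}"
      by (auto simp: fibre_def)
    have "(x, y) \<notin> contraction (g ` X) (?F H) N" for x y
    proof
      assume "(x, y) \<in> contraction (g ` X) (?F H) N"
      then obtain a b where ab: "x = g a" "a \<in> X" "y = g b" "b \<in> X" "x \<noteq> y"
        and con: "(x, y) \<in> (N \<union> ?F H)\<^sup>*" by (auto simp: contraction_def)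
      have "y \<in> g ` {c \<in> V. (a, c) \<in> (M \<union> H)\<^sup>*}"
      proof (rule closed_rtrancl[OF con])
        fix u v assume "u \<in> g ` {c \<in> V. (a, c) \<in> (M \<union> H)\<^sup>*}" and uv: "(u, v) \<in> N \<union> ?F H"
        then obtain c where c: "c \<in> V" "(a, c) \<in> (M \<union> H)\<^sup>*" "u = g c" by auto
        obtain d e where de: "(d, e) \<in> M \<union> H" "u = g d" "v = g e" using uv N by auto
        have "d \<in> V" "e \<in> V" using de(1) matchingsD[OF M(1)] matchingsD[OF H] by blast+
        then show "v \<in> g ` {c \<in> V. (a, c) \<in> (M \<union> H)\<^sup>*}"
          using c de g(1) by (auto dest!: inj_onD intro: rtrancl.rtrancl_into_rtrancl)
      qed (use ab X in auto)
      then obtain c where "c \<in> V" "(a, c) \<in> (M \<union> H)\<^sup>*" "y = g c" by auto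
      moreover have "c = b" using calculation ab X g(1) by (metis inj_onD subsetD)
      ultimately have "(a, b) \<in> contraction X H M" using ab by (auto simp: contraction_def)
      then show False using M(2) by simp
    qed
    then show "N \<in> fibre W (g ` X) (?F H) {}"
      using map_matching[OF M(1) g] N by (auto simp: fibre_def)
  qed
qed

text \<open>
  Used twice: to compare contractions along matchings of different sizes, and to relabel a diagram,
  where the permutation must extend a given bijection \<open>t\<close> of the ends of transversals.
\<close>

lemma matching_embedding_permutation:
  assumes A: "finite A" "S \<subseteq> A" "T \<subseteq> A" and t: "bij_betw t S T"
    and M: "M \<in> matchings (A - S)" and N: "N \<in> matchings (A - T)" and le: "card M \<le> card N"
  shows "\<exists>f. f permutes A \<and> (\<forall>x\<in>S. f x = t x) \<and> map_prod f f ` M \<subseteq> N"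
proof -
  have fin: "finite M" "finite N"
    using finite_matching[OF M] finite_matching[OF N] A(1) by auto
  obtain h where h: "inj_on h (Domain M)" "map_prod h h ` M \<subseteq> N"
    using embed_matching[OF fin M N le] by blast
  have "h ` Domain M \<subseteq> A - T" using h(2) matchingsD(1)[OF N] by force
  moreover have "card (A - S) = card (A - T)"
    using A bij_betw_same_card[OF t]
    by (simp add: card_Diff_subset finite_subset[OF A(2)] finite_subset[OF A(3)])
  moreover have "Domain M \<subseteq> A - S" using matchingsD(1)[OF M] by blast
  ultimately obtain g where g: "bij_betw g (A - S) (A - T)" "\<And>x. x \<in> Domain M \<Longrightarrow> g x = h x"
    using extend_injection_to_bijection[of "A - S" "A - T" "Domain M" h] h(1) A(1) by auto
  define f where "f x = (if x \<in> S then t x else if x \<in> A then g x else x)" for x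
  have "bij_betw f S T" using t by (subst bij_betw_cong[of _ _ t]) (auto simp: f_def)
  moreover have "bij_betw f (A - S) (A - T)"
    using g(1) by (subst bij_betw_cong[of _ _ g]) (auto simp: f_def)
  ultimately have "bij_betw f (S \<union> (A - S)) (T \<union> (A - T))"
    by (rule bij_betw_combine) auto
  moreover have "S \<union> (A - S) = A" "T \<union> (A - T) = A" using A by auto
  ultimately have "bij_betw f A A" by simp
  then have "f permutes A" by (rule bij_imp_permutes) (use A(2) in \<open>auto simp: f_def\<close>)
  moreover have fh: "f x = h x" if "x \<in> Domain M" for x
    using that g(2) matchingsD(1)[OF M] by (auto simp: f_def)
  have "map_prod f f e \<in> N" if "e \<in> M" for e
  proof -
    obtain a b where e: "e = (a, b)" by (cases e)
    have "a \<in> Domain M" "b \<in> Domain M" using that e matchingsD(3)[OF M] by blast+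
    then have "map_prod f f e = map_prod h h e" using fh e by simp
    then show ?thesis using h(2) that by auto
  qed
  then have "map_prod f f ` M \<subseteq> N" by (rule image_subsetI)
  ultimately show ?thesis by (intro exI[of _ f]) (auto simp: f_def)
qed

text \<open>
  A permutation of \<open>V\<close> takes \<open>X\<close> to \<open>Y\<close> and \<open>H\<close> to a proper subset of \<open>K\<close>, which reduces the claim to
  a comparison on a common boundary.
\<close>

lemma card_empty_fibre_less:
  assumes V: "finite V" "X \<subseteq> V" "Y \<subseteq> V" and XY: "card X = card Y" "2 \<le> card X"
    and H: "H \<in> matchings (V - X)" and K: "K \<in> matchings (V - Y)" and less: "card H < card K"
  shows "card (fibre V Y K {}) < card (fibre V X H {})"
proof -
  obtain t where t: "bij_betw t X Y"
    using finite_same_card_bij[OF finite_subset[OF V(2,1)] finite_subset[OF V(3,1)] XY(1)] by blast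
  obtain g where g: "g permutes V" "\<And>x. x \<in> X \<Longrightarrow> g x = t x" "map_prod g g ` H \<subseteq> K"
    using matching_embedding_permutation[OF V t H K] less by auto
  have gX: "g ` X = Y" using t g(2) by (simp add: bij_betw_def)
  have "finite H"
    using finite_matching[OF H] V(1) by simp
  then have "card (map_prod g g ` H) \<le> card H" by (rule card_image_le)
  then have gHK: "map_prod g g ` H \<subset> K" using g(3) less by auto
  have gH: "map_prod g g ` H \<in> matchings (V - Y)"
    by (rule map_matching[OF H])
      (use permutes_inj[OF g(1)] permutes_image[OF g(1)] gX in \<open>auto simp: image_set_diff intro: inj_on_subset\<close>)
  have "\<not> card Y \<le> Suc 0" using XY by simp
  then obtain x y where xy: "x \<in> Y" "y \<in> Y" "x \<noteq> y"
    using card_le_Suc0_iff_eq[OF finite_subset[OF V(3,1)]] by auto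
  define g' where "g' = Hilbert_Choice.inv g"
  have g': "g' permutes V" and inv: "g' (g v) = v" for v
    using permutes_inv[OF g(1)] permutes_inverses(2)[OF g(1)] by (auto simp: g'_def)
  have "card (fibre V Y K {}) < card (fibre V Y (map_prod g g ` H) {})"
    by (rule card_empty_fibre_strict[OF V(1,3) K gHK gH xy])
  also have "\<dots> \<le> card (fibre V (g' ` Y) (map_prod g' g' ` map_prod g g ` H) {})"
    using permutes_inj_on[OF g'] permutes_image[OF g']
    by (intro card_empty_fibre_transport[OF V(1) _ _ gH V(3)]) auto
  also have "g' ` Y = X" unfolding gX[symmetric] image_image by (simp add: inv)
  also have "map_prod g' g' ` map_prod g g ` H = H"
    by (simp add: image_image map_prod_def split_beta inv)
  finally show ?thesis .
qed

text \<open>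
  Only the partition of the matchings into fibres is transported by \<open>\<psi>\<close>, not the contractions
  themselves. So the fibre of \<open>{}\<close> may land in any fibre; it is compared with the fibre of \<open>{}\<close> on the
  other side because that one is the largest.
\<close>

lemma contraction_kernel_embedding:
  assumes V: "finite V" "X \<subseteq> V" "Y \<subseteq> V"
    and H: "H \<in> matchings (V - X)" and K: "K \<in> matchings (V - Y)"
    and \<psi>: "bij_betw \<psi> (matchings V) (matchings V)"
    and ker: "\<And>M N. M \<in> matchings V \<Longrightarrow> N \<in> matchings V \<Longrightarrow>
      contraction X H M = contraction X H N \<longleftrightarrow> contraction Y K (\<psi> M) = contraction Y K (\<psi> N)"
  shows "card (matchings X) \<le> card (matchings Y)"
    "card (fibre V X H {}) \<le> card (fibre V Y K {})"
proof -
  let ?A = "matchings V" and ?f = "contraction X H" and ?h = "contraction Y K"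
  have "card (?f ` ?A) \<le> card (?h ` ?A)"
  proof (rule card_inj_on_le)
    let ?k = "\<lambda>c. ?h (\<psi> (inv_into ?A ?f c))"
    show "inj_on ?k (?f ` ?A)"
      by (rule inj_onI) (metis ker inv_into_into f_inv_into_f)
    show "?k ` (?f ` ?A) \<subseteq> ?h ` ?A"
    proof
      fix c assume "c \<in> ?k ` (?f ` ?A)"
      then obtain M where "M \<in> ?A" "c = ?k (?f M)" by auto
      moreover have "inv_into ?A ?f (?f M) \<in> ?A" using \<open>M \<in> ?A\<close> by (intro inv_into_into) simp
      ultimately show "c \<in> ?h ` ?A" using bij_betwE[OF \<psi>] by blast
    qed
  qed (simp add: finite_matchings V)
  then show "card (matchings X) \<le> card (matchings Y)"
    using contraction_image[OF V(2) H] contraction_image[OF V(3) K] by simp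
  have e: "{} \<in> ?A" "?f {} = {}"
    using contraction_of_matching[OF empty_matching H] empty_matching by auto
  let ?\<gamma> = "?h (\<psi> {})"
  have sub: "\<psi> ` fibre V X H {} \<subseteq> fibre V Y K ?\<gamma>"
  proof
    fix N assume "N \<in> \<psi> ` fibre V X H {}"
    then obtain M where M: "N = \<psi> M" "M \<in> ?A" "?f M = {}" by (auto simp: fibre_def)
    then show "N \<in> fibre V Y K ?\<gamma>"
      using ker[OF M(2) e(1)] e(2) \<psi> by (auto simp: fibre_def bij_betw_def)
  qed
  have ne: "fibre V Y K ?\<gamma> \<noteq> {}" using sub e by (auto simp: fibre_def)
  have "?\<gamma> \<in> matchings Y"
    using contraction_matching[OF _ K] \<psi> e(1) by (auto simp: bij_betw_def)
  then have fin: "finite ?\<gamma>"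
    using finite_matching finite_subset[OF V(3,1)] by blast
  have "card (fibre V X H {}) \<le> card (fibre V Y K ?\<gamma>)"
  proof (rule card_inj_on_le[OF _ sub finite_fibre[OF V(1)]])
    show "inj_on \<psi> (fibre V X H {})"
      using \<psi> by (auto simp: bij_betw_def fibre_def intro: inj_on_subset)
  qed
  also have "\<dots> \<le> card (fibre V Y K {})" by (rule card_fibre_le[OF V(1) K fin ne])
  finally show "card (fibre V X H {}) \<le> card (fibre V Y K {})" .
qed

text \<open>
  The number of fibres determines the size of the boundary, and then the size of the largest fibre
  determines the number of edges contracted along.
\<close>

lemma contraction_kernel_determines:
  assumes V: "finite V" "X \<subseteq> V" "Y \<subseteq> V" and XY: "2 \<le> card X" "2 \<le> card Y"
    and H: "H \<in> matchings (V - X)" and K: "K \<in> matchings (V - Y)"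
    and \<psi>: "bij_betw \<psi> (matchings V) (matchings V)"
    and ker: "\<And>M N. M \<in> matchings V \<Longrightarrow> N \<in> matchings V \<Longrightarrow>
      contraction X H M = contraction X H N \<longleftrightarrow> contraction Y K (\<psi> M) = contraction Y K (\<psi> N)"
  shows "card X = card Y" "card H = card K"
proof -
  let ?\<phi> = "inv_into (matchings V) \<psi>"
  have ker': "contraction Y K M = contraction Y K N \<longleftrightarrow> contraction X H (?\<phi> M) = contraction X H (?\<phi> N)"
    if "M \<in> matchings V" "N \<in> matchings V" for M N
  proof -
    have "?\<phi> M \<in> matchings V" "?\<phi> N \<in> matchings V" "\<psi> (?\<phi> M) = M" "\<psi> (?\<phi> N) = N"
      using that \<psi> by (auto simp: bij_betw_def inv_into_into f_inv_into_f)
    then show ?thesis using ker[of "?\<phi> M" "?\<phi> N"] by simp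
  qed
  note le = contraction_kernel_embedding[OF V H K \<psi> ker]
  note ge = contraction_kernel_embedding[OF V(1,3,2) K H bij_betw_inv_into[OF \<psi>] ker']
  have fin: "finite X" "finite Y" using V finite_subset by auto
  show XY': "card X = card Y"
    using card_matchings_strict[OF fin(2), of X] card_matchings_strict[OF fin(1), of Y] le(1) ge(1) XY
    by linarith
  show "card H = card K"
    using card_empty_fibre_less[OF V XY' XY(1) H K] 
      card_empty_fibre_less[OF V(1,3,2) XY'[symmetric] XY(2) K H] le(2) ge(2)
    by linarith
qed

section \<open>Diagrams as matchings of their vertices\<close>

lemma PB_carrier [simp]: "carrier (PB n) = partial_brauer_diagrams n"
  by (simp add: PB_def)

lemma finite_diagram_vertices: "finite (diagram_vertices n)"
  by (simp add: diagram_vertices_def)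

lemma diagram_vertices_cases:
  assumes "v \<in> diagram_vertices n"
  obtains (upper) i where "v = Upper i" "i \<in> {1..n}" | (lower) i where "v = Lower i" "i \<in> {1..n}"
  using assms unfolding diagram_vertices_def by blast

lemma diagram_edges_sym: "(u, v) \<in> diagram_edges \<alpha> \<Longrightarrow> (v, u) \<in> diagram_edges \<alpha>"
  by (auto simp: diagram_edges_def insert_commute)

lemma diagram_edges_matching:
  assumes "\<alpha> \<in> partial_brauer_diagrams n"
  shows "diagram_edges \<alpha> \<in> matchings (diagram_vertices n)"
proof (rule matchingsI)
  have P: "partition_on (diagram_vertices n) \<alpha>" using assms by (simp add: partial_brauer_diagrams_def)
  show "x \<in> diagram_vertices n" if "(x, y) \<in> diagram_edges \<alpha>" for x y
    using that partition_onD1[OF P] by (auto simp: diagram_edges_def)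
  show "y = z" if "(x, y) \<in> diagram_edges \<alpha>" "(x, z) \<in> diagram_edges \<alpha>" for x y z
  proof -
    have "{x, y} \<in> \<alpha>" "{x, z} \<in> \<alpha>" "x \<noteq> y" "x \<noteq> z" using that by (auto simp: diagram_edges_def)
    then have "{x, y} = {x, z}" using disjointD[OF partition_onD2[OF P]] by blast
    then show ?thesis using \<open>x \<noteq> y\<close> by (metis doubleton_eq_iff)
  qed
qed (auto simp: diagram_edges_def insert_commute)

definition matching_diagram :: "nat \<Rightarrow> vertex rel \<Rightarrow> diagram" where
  "matching_diagram n M =
     {{u, v} | u v. (u, v) \<in> M} \<union> {{u} | u. u \<in> diagram_vertices n - Domain M}"

lemma matching_diagram_edges:
  assumes \<alpha>: "\<alpha> \<in> partial_brauer_diagrams n"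
  shows "matching_diagram n (diagram_edges \<alpha>) = \<alpha>"
proof -
  have P: "partition_on (diagram_vertices n) \<alpha>" and two: "\<And>B. B \<in> \<alpha> \<Longrightarrow> card B \<le> 2"
    using \<alpha> by (auto simp: partial_brauer_diagrams_def)
  have block: "(\<exists>v. B = {u, v} \<and> (u, v) \<in> diagram_edges \<alpha>) \<or> (B = {u} \<and> u \<in> diagram_vertices n - Domain (diagram_edges \<alpha>))"
    if B: "B \<in> \<alpha>" "u \<in> B" for B u
  proof -
    have sub: "B \<subseteq> diagram_vertices n" using B(1) partition_onD1[OF P] by blast
    then have fin: "finite B" using finite_diagram_vertices finite_subset by blast
    show ?thesis
    proof (cases "B = {u}")
      case True
      have "(u, v) \<notin> diagram_edges \<alpha>" for v
      proof
        assume uv: "(u, v) \<in> diagram_edges \<alpha>"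
        then have "{u, v} \<in> \<alpha>" "u \<noteq> v" by (auto simp: diagram_edges_def)
        then show False using disjointD[OF partition_onD2[OF P] B(1), of "{u, v}"] True by auto
      qed
      then show ?thesis using True sub by auto
    next
      case False
      then obtain v where v: "v \<in> B" "v \<noteq> u" using B(2) by blast
      then have "{u, v} = B" using B(2) two[OF B(1)] fin
        by (intro card_seteq) auto
      then show ?thesis using v B(1) by (auto simp: diagram_edges_def)
    qed
  qed
  show ?thesis
  proof (intro equalityI subsetI)
    fix B assume B: "B \<in> matching_diagram n (diagram_edges \<alpha>)"
    then consider u v where "B = {u, v}" "(u, v) \<in> diagram_edges \<alpha>"
      | u where "B = {u}" "u \<in> diagram_vertices n" "u \<notin> Domain (diagram_edges \<alpha>)"
      unfolding matching_diagram_def by blast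
    then show "B \<in> \<alpha>"
    proof cases
      case 1 then show ?thesis by (simp add: diagram_edges_def)
    next
      case 2
      then obtain C where "C \<in> \<alpha>" "u \<in> C" using partition_onD1[OF P] by blast
      then show ?thesis using block 2 by blast
    qed
  next
    fix B assume B: "B \<in> \<alpha>"
    then obtain u where "u \<in> B" using partition_onD3[OF P] by (metis all_not_in_conv)
    then show "B \<in> matching_diagram n (diagram_edges \<alpha>)"
      using block[OF B] unfolding matching_diagram_def by blast
  qed
qed

lemma edges_matching_diagram:
  assumes "M \<in> matchings (diagram_vertices n)"
  shows "diagram_edges (matching_diagram n M) = M"
  using matchingsD[OF assms]
  unfolding diagram_edges_def matching_diagram_def by (auto simp: doubleton_eq_iff)

lemma matching_diagram_PB:
  assumes M: "M \<in> matchings (diagram_vertices n)"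
  shows "matching_diagram n M \<in> partial_brauer_diagrams n"
proof -
  have "partition_on (diagram_vertices n) (matching_diagram n M)"
  proof (rule partition_onI)
    have "\<exists>B\<in>matching_diagram n M. u \<in> B" if "u \<in> diagram_vertices n" for u
    proof (cases "u \<in> Domain M")
      case True
      then obtain v where "(u, v) \<in> M" by blast
      then have "{u, v} \<in> matching_diagram n M" by (auto simp: matching_diagram_def)
      then show ?thesis by blast
    next
      case False
      then have "{u} \<in> matching_diagram n M" using that by (auto simp: matching_diagram_def)
      then show ?thesis by blast
    qed
    moreover have "B \<subseteq> diagram_vertices n" if "B \<in> matching_diagram n M" for B
      using that matchingsD(1,2)[OF M] by (auto simp: matching_diagram_def)
    ultimately show "\<Union> (matching_diagram n M) = diagram_vertices n" by blast
    fix B C assume BC: "B \<in> matching_diagram n M" "C \<in> matching_diagram n M" "B \<noteq> C"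
    show "disjnt B C"
    proof (rule ccontr)
      assume "\<not> disjnt B C"
      then obtain u where u: "u \<in> B" "u \<in> C" by (auto simp: disjnt_def)
      have "D = {u} \<and> u \<notin> Domain M \<or> (\<exists>v. D = {u, v} \<and> (u, v) \<in> M)"
        if D: "D \<in> matching_diagram n M" "u \<in> D" for D
      proof -
        from D(1) consider a b where "D = {a, b}" "(a, b) \<in> M" | a where "D = {a}" "a \<notin> Domain M"
          unfolding matching_diagram_def by blast
        then show ?thesis
        proof cases
          case (1 a b)
          then have "u = a \<or> u = b" "(b, a) \<in> M" using D(2) matchingsD(3)[OF M] by auto
          then show ?thesis using 1 by (metis insert_commute)
        qed (use D(2) in simp)
      qed
      from this[OF BC(1) u(1)] this[OF BC(2) u(2)] show False
        using BC(3) matchingsD(5)[OF M] by (metis DomainI)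
    qed
  qed (auto simp: matching_diagram_def)
  moreover have "card B \<le> 2" if "B \<in> matching_diagram n M" for B
    using that unfolding matching_diagram_def by (auto simp: card_insert_if)
  ultimately show ?thesis by (simp add: partial_brauer_diagrams_def)
qed

lemma bij_betw_diagram_edges:
  "bij_betw diagram_edges (partial_brauer_diagrams n) (matchings (diagram_vertices n))"
  by (rule bij_betw_byWitness[where f' = "matching_diagram n"])
    (auto simp: matching_diagram_edges edges_matching_diagram diagram_edges_matching matching_diagram_PB)

definition product_edges :: "nat \<Rightarrow> diagram \<Rightarrow> diagram \<Rightarrow> vertex rel" where
  "product_edges n \<alpha> \<beta> = {(u, v). u \<in> diagram_vertices n \<and> v \<in> diagram_vertices n \<and> u \<noteq> v \<and>
     (u, v) \<in> (product_graph \<alpha> \<beta>)\<^sup>*}"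

lemma diagram_mult_eq: "diagram_mult n \<alpha> \<beta> = matching_diagram n (product_edges n \<alpha> \<beta>)"
  unfolding diagram_mult_def matching_diagram_def product_edges_def Let_def by auto

section \<open>Right multiplication by a diagram as a contraction\<close>

text \<open>
  In a product \<open>\<xi>\<alpha>\<close> the vertices \<open>Lower i\<close> of \<open>\<xi>\<close> are glued to the vertices \<open>Upper i\<close> of \<open>\<alpha>\<close>. The
  following describes \<open>\<alpha>\<close> as seen by \<open>\<xi>\<close>: its upper hooks become edges between lower vertices of
  \<open>\<xi>\<close>, and the input vertices are those vertices of \<open>\<xi>\<close> that are visible in the product, each at its
  exit vertex.
\<close>

definition input_vertices :: "nat \<Rightarrow> diagram \<Rightarrow> vertex set" where
  "input_vertices n \<alpha> = Upper ` {1..n} \<union> {Lower i | i j. (Upper i, Lower j) \<in> diagram_edges \<alpha>}"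

definition cap_edges :: "diagram \<Rightarrow> vertex rel" where
  "cap_edges \<alpha> = {(Lower i, Lower j) | i j. (Upper i, Upper j) \<in> diagram_edges \<alpha>}"

definition cup_edges :: "diagram \<Rightarrow> vertex rel" where
  "cup_edges \<alpha> = {(Lower i, Lower j) | i j. (Lower i, Lower j) \<in> diagram_edges \<alpha>}"

fun exit_vertex :: "diagram \<Rightarrow> vertex \<Rightarrow> vertex" where
  "exit_vertex \<alpha> (Lower i) = partner (diagram_edges \<alpha>) (Upper i)"
| "exit_vertex \<alpha> v = v"

lemma no_middle: "Middle i \<notin> diagram_vertices n"
  by (auto simp: diagram_vertices_def)

context
  fixes n :: nat and \<alpha> :: diagram
  assumes \<alpha>: "\<alpha> \<in> partial_brauer_diagrams n"
begin

lemmas E\<alpha> = matchingsD[OF diagram_edges_matching[OF \<alpha>]]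

lemma exit_Lower: "(Upper i, Lower j) \<in> diagram_edges \<alpha> \<Longrightarrow> exit_vertex \<alpha> (Lower i) = Lower j"
  using partner_eq[OF diagram_edges_matching[OF \<alpha>]] by simp

lemma input_vertices_subset: "input_vertices n \<alpha> \<subseteq> diagram_vertices n"
  using E\<alpha>(1) unfolding input_vertices_def diagram_vertices_def by blast

lemma cap_edges_matching: "cap_edges \<alpha> \<in> matchings (diagram_vertices n - input_vertices n \<alpha>)"
proof (rule matchingsI)
  show "x \<in> diagram_vertices n - input_vertices n \<alpha>" if xy: "(x, y) \<in> cap_edges \<alpha>" for x y
  proof -
    obtain i j where ij: "x = Lower i" "(Upper i, Upper j) \<in> diagram_edges \<alpha>"
      using xy by (auto simp: cap_edges_def)
    have "(Upper i, Lower k) \<notin> diagram_edges \<alpha>" for k using E\<alpha>(5)[OF ij(2)] by blast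
    moreover have "i \<in> {1..n}" using E\<alpha>(1)[OF ij(2)] by (auto simp: diagram_vertices_def)
    ultimately show ?thesis using ij(1) by (auto simp: input_vertices_def diagram_vertices_def)
  qed
qed (use E\<alpha>(3,4,5) in \<open>force simp: cap_edges_def\<close>)+

lemma input_cases:
  assumes "x \<in> input_vertices n \<alpha>"
  obtains (upper) i where "x = Upper i" "exit_vertex \<alpha> x = Upper i" "i \<in> {1..n}"
  | (lower) i j where "x = Lower i" "exit_vertex \<alpha> x = Lower j" "(Upper i, Lower j) \<in> diagram_edges \<alpha>"
  using assms exit_Lower unfolding input_vertices_def by auto

lemma inj_on_exit: "inj_on (exit_vertex \<alpha>) (input_vertices n \<alpha>)"
proof (rule inj_onI)
  fix x y assume xy: "x \<in> input_vertices n \<alpha>" "y \<in> input_vertices n \<alpha>" "exit_vertex \<alpha> x = exit_vertex \<alpha> y"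
  show "x = y"
    using xy(1)
  proof (cases rule: input_cases)
    case (upper i)
    from xy(2) show ?thesis by (cases rule: input_cases) (use upper xy(3) in auto)
  next
    case (lower i j)
    from xy(2) show ?thesis
    proof (cases rule: input_cases)
      case (lower i' j')
      then show ?thesis using xy(3) \<open>x = Lower i\<close> \<open>exit_vertex \<alpha> x = Lower j\<close> 
          \<open>(Upper i, Lower j) \<in> diagram_edges \<alpha>\<close> E\<alpha>(3,5) by (metis vertex.inject)
    qed (use lower xy(3) in auto)
  qed
qed

lemma exit_in_vertices: "x \<in> input_vertices n \<alpha> \<Longrightarrow> exit_vertex \<alpha> x \<in> diagram_vertices n"
  by (cases x rule: input_cases) (use E\<alpha>(2) in \<open>auto simp: diagram_vertices_def\<close>)

lemma cup_edges_matching: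
  "cup_edges \<alpha> \<in> matchings (diagram_vertices n - exit_vertex \<alpha> ` input_vertices n \<alpha>)"
proof (rule matchingsI)
  show "x \<in> diagram_vertices n - exit_vertex \<alpha> ` input_vertices n \<alpha>" if xy: "(x, y) \<in> cup_edges \<alpha>" for x y
  proof -
    obtain i j where ij: "x = Lower i" "(Lower i, Lower j) \<in> diagram_edges \<alpha>"
      using xy by (auto simp: cup_edges_def)
    have "x \<noteq> exit_vertex \<alpha> z" if "z \<in> input_vertices n \<alpha>" for z
      using that
    proof (cases rule: input_cases)
      case (lower k l)
      then show ?thesis using E\<alpha>(3)[OF lower(3)] E\<alpha>(5)[OF ij(2)] ij(1) by fastforce
    qed (use ij in auto)
    then show ?thesis using E\<alpha>(1)[OF ij(2)] ij(1) by auto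
  qed
qed (use E\<alpha>(3,4,5) in \<open>force simp: cup_edges_def\<close>)+

context
  fixes \<xi> :: diagram
  assumes \<xi>: "\<xi> \<in> partial_brauer_diagrams n"
begin

lemmas E\<xi> = matchingsD[OF diagram_edges_matching[OF \<xi>]]

lemma product_graph_cases:
  assumes "(a, b) \<in> product_graph \<xi> \<alpha>"
  obtains (left) u v where "a = lower_to_middle u" "b = lower_to_middle v" "(u, v) \<in> diagram_edges \<xi>"
  | (right) u v where "a = upper_to_middle u" "b = upper_to_middle v" "(u, v) \<in> diagram_edges \<alpha>"
  using assms unfolding product_graph_def by auto

lemma product_graph_left: "(u, v) \<in> diagram_edges \<xi> \<Longrightarrow> (lower_to_middle u, lower_to_middle v) \<in> product_graph \<xi> \<alpha>"
  unfolding product_graph_def by (force simp: image_iff)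

lemma product_graph_right: "(u, v) \<in> diagram_edges \<alpha> \<Longrightarrow> (upper_to_middle u, upper_to_middle v) \<in> product_graph \<xi> \<alpha>"
  unfolding product_graph_def by (force simp: image_iff)

lemma sym_product_graph: "sym ((product_graph \<xi> \<alpha>)\<^sup>*)"
  using product_graph_left product_graph_right diagram_edges_sym
  by (intro sym_rtrancl symI) (metis product_graph_cases)

lemma exit_connected:
  assumes "x \<in> input_vertices n \<alpha>"
  shows "(lower_to_middle x, exit_vertex \<alpha> x) \<in> (product_graph \<xi> \<alpha>)\<^sup>*"
  using assms
proof (cases rule: input_cases)
  case (lower i j)
  then show ?thesis using product_graph_right[OF lower(3)] by auto
qed auto

text \<open>
  The stated set is closed under the edges of the product graph: within \<open>\<xi>\<close> and the upper hooks of
  \<open>\<alpha>\<close> one moves inside \<open>K\<close>, and a transversal of \<open>\<alpha>\<close> only leads to an exit vertex and back.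
\<close>

lemma vertex_reaches:
  assumes con: "(lower_to_middle x, z) \<in> (product_graph \<xi> \<alpha>)\<^sup>*" and x: "x \<in> diagram_vertices n"
  defines "K \<equiv> {y. (x, y) \<in> (diagram_edges \<xi> \<union> cap_edges \<alpha>)\<^sup>*}"
  shows "z \<in> lower_to_middle ` (K \<inter> diagram_vertices n) \<union> exit_vertex \<alpha> ` (K \<inter> input_vertices n \<alpha>)"
proof (rule closed_rtrancl[OF con])
  show "lower_to_middle x \<in> lower_to_middle ` (K \<inter> diagram_vertices n) \<union> exit_vertex \<alpha> ` (K \<inter> input_vertices n \<alpha>)"
    using x by (auto simp: K_def)
  fix a b assume a: "a \<in> lower_to_middle ` (K \<inter> diagram_vertices n) \<union> exit_vertex \<alpha> ` (K \<inter> input_vertices n \<alpha>)"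
    and ab: "(a, b) \<in> product_graph \<xi> \<alpha>"
  have K: "d \<in> K" if "c \<in> K" "(c, d) \<in> diagram_edges \<xi> \<union> cap_edges \<alpha>" for c d
    using that by (auto simp: K_def intro: rtrancl.rtrancl_into_rtrancl)
  have left: "b \<in> lower_to_middle ` (K \<inter> diagram_vertices n) \<union> exit_vertex \<alpha> ` (K \<inter> input_vertices n \<alpha>)"
    if c: "a = lower_to_middle c" "c \<in> K" "c \<in> diagram_vertices n" for c
    using ab
  proof (cases rule: product_graph_cases)
    case (left u v)
    have "u = c" using left(1) c(1,3) E\<xi>(1)[OF left(3)] no_middle by (cases u; cases c) auto
    then show ?thesis using left K[OF c(2), of v] E\<xi>(2) by auto
  next
    case (right u v)
    then obtain i where i: "u = Upper i" "c = Lower i"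
      using c(1,3) E\<alpha>(1)[OF right(3)] no_middle by (cases u; cases c) auto
    show ?thesis
    proof (cases v)
      case (Upper j)
      then have "(c, Lower j) \<in> cap_edges \<alpha>" using right i by (auto simp: cap_edges_def)
      then have "Lower j \<in> K" using K[OF c(2)] by blast
      moreover have "Lower j \<in> diagram_vertices n" using E\<alpha>(2)[OF right(3)] Upper by (auto simp: diagram_vertices_def)
      moreover have "b = lower_to_middle (Lower j)" using right Upper by simp
      ultimately show ?thesis by blast
    next
      case (Lower j)
      then have "c \<in> input_vertices n \<alpha>" using right i by (auto simp: input_vertices_def)
      moreover have "b = exit_vertex \<alpha> c" using right i Lower exit_Lower by simp
      ultimately show ?thesis using c(2) by blast
    next
      case (Middle j)
      then show ?thesis using E\<alpha>(2)[OF right(3)] no_middle by auto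
    qed
  qed
  from a consider c where "a = lower_to_middle c" "c \<in> K" "c \<in> diagram_vertices n"
    | c where "a = exit_vertex \<alpha> c" "c \<in> K" "c \<in> input_vertices n \<alpha>" by blast
  then show "b \<in> lower_to_middle ` (K \<inter> diagram_vertices n) \<union> exit_vertex \<alpha> ` (K \<inter> input_vertices n \<alpha>)"
  proof cases
    case 1 then show ?thesis by (rule left)
  next
    case 2
    from 2(3) show ?thesis
    proof (cases rule: input_cases)
      case (upper i)
      then show ?thesis using left[of c] 2 input_vertices_subset by auto
    next
      case (lower i j)
      from ab show ?thesis
      proof (cases rule: product_graph_cases)
        case (left u v)
        then show ?thesis using 2 lower by (cases u) auto
      next
        case (right u v)
        then have "u = Lower j" using 2 lower by (cases u) auto
        then have "v = Upper i" using right(3) E\<alpha>(3)[OF lower(3)] E\<alpha>(5) by blast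
        then have "b = lower_to_middle c" using right lower by simp
        then show ?thesis using 2 input_vertices_subset by blast
      qed
    qed
  qed
qed

lemma connected_exits_iff:
  assumes "x \<in> input_vertices n \<alpha>" "y \<in> input_vertices n \<alpha>"
  shows "(exit_vertex \<alpha> x, exit_vertex \<alpha> y) \<in> (product_graph \<xi> \<alpha>)\<^sup>* \<longleftrightarrow>
    (x, y) \<in> (diagram_edges \<xi> \<union> cap_edges \<alpha>)\<^sup>*"
proof
  assume "(exit_vertex \<alpha> x, exit_vertex \<alpha> y) \<in> (product_graph \<xi> \<alpha>)\<^sup>*"
  then have con: "(lower_to_middle x, exit_vertex \<alpha> y) \<in> (product_graph \<xi> \<alpha>)\<^sup>*"
    using exit_connected[OF assms(1)] by (rule rtrancl_trans[rotated])
  have "x \<in> diagram_vertices n" using assms(1) input_vertices_subset by auto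
  from vertex_reaches[OF con this]
  consider c where "exit_vertex \<alpha> y = lower_to_middle c" "(x, c) \<in> (diagram_edges \<xi> \<union> cap_edges \<alpha>)\<^sup>*"
    | c where "exit_vertex \<alpha> y = exit_vertex \<alpha> c" "c \<in> input_vertices n \<alpha>" "(x, c) \<in> (diagram_edges \<xi> \<union> cap_edges \<alpha>)\<^sup>*"
    by blast
  then show "(x, y) \<in> (diagram_edges \<xi> \<union> cap_edges \<alpha>)\<^sup>*"
  proof cases
    case 1
    from assms(2) show ?thesis by (cases rule: input_cases; cases c) (use 1 in auto)
  next
    case 2 then show ?thesis using inj_on_exit assms(2) by (metis inj_onD)
  qed
next
  assume "(x, y) \<in> (diagram_edges \<xi> \<union> cap_edges \<alpha>)\<^sup>*"
  then have "(lower_to_middle x, lower_to_middle y) \<in> (product_graph \<xi> \<alpha>)\<^sup>*"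
  proof (induction rule: rtrancl_induct)
    case (step c d)
    have "(lower_to_middle c, lower_to_middle d) \<in> product_graph \<xi> \<alpha>"
      using step(2) product_graph_left product_graph_right by (force simp: cap_edges_def)
    then show ?case using step(3) by (rule rtrancl.rtrancl_into_rtrancl[rotated])
  qed simp
  then show "(exit_vertex \<alpha> x, exit_vertex \<alpha> y) \<in> (product_graph \<xi> \<alpha>)\<^sup>*"
    using exit_connected assms symD[OF sym_product_graph] by (meson rtrancl_trans)
qed

text \<open>
  These are the lower vertices of \<open>\<alpha>\<close> outside transversals; nothing of \<open>\<xi>\<close> reaches them.
\<close>

lemma non_exit_reaches:
  assumes u: "u \<in> diagram_vertices n" "u \<notin> exit_vertex \<alpha> ` input_vertices n \<alpha>"
    and con: "(u, v) \<in> (product_graph \<xi> \<alpha>)\<^sup>*"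
  shows "v = u \<or> (u, v) \<in> cup_edges \<alpha>"
proof -
  have "u \<noteq> Upper i" for i
  proof
    assume "u = Upper i"
    then have "u \<in> input_vertices n \<alpha>" "exit_vertex \<alpha> u = u"
      using u(1) by (auto simp: input_vertices_def diagram_vertices_def)
    then show False using u(2) by (metis image_eqI)
  qed
  then obtain j where j: "u = Lower j" using u(1) by (auto simp: diagram_vertices_def)
  have no: "(Upper i, Lower j) \<notin> diagram_edges \<alpha>" for i
  proof
    assume ij: "(Upper i, Lower j) \<in> diagram_edges \<alpha>"
    then have "Lower i \<in> input_vertices n \<alpha>" by (auto simp: input_vertices_def)
    then show False using u(2) exit_Lower[OF ij] j by (metis image_eqI)
  qed
  have "v \<in> {v. v = u \<or> (u, v) \<in> cup_edges \<alpha>}"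
  proof (rule closed_rtrancl[OF con])
    fix a b assume a: "a \<in> {v. v = u \<or> (u, v) \<in> cup_edges \<alpha>}" and ab: "(a, b) \<in> product_graph \<xi> \<alpha>"
    then obtain k where k: "a = Lower k" using j by (auto simp: cup_edges_def)
    from ab show "b \<in> {v. v = u \<or> (u, v) \<in> cup_edges \<alpha>}"
    proof (cases rule: product_graph_cases)
      case (left c d)
      then show ?thesis using k by (cases c) auto
    next
      case (right c d)
      then have c: "c = a" using k by (cases c) auto
      show ?thesis
      proof (cases "a = u")
        case True
        then have jd: "(Lower j, d) \<in> diagram_edges \<alpha>" using right(3) c j by simp
        then have "d \<in> diagram_vertices n" "\<And>i. d \<noteq> Upper i" using E\<alpha>(2,3) no by blast+
        then obtain k where "d = Lower k" using no_middle by (cases d) auto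
        then show ?thesis using jd right(2) j by (auto simp: cup_edges_def)
      next
        case False
        then have "(Lower j, a) \<in> diagram_edges \<alpha>" using a j by (auto simp: cup_edges_def)
        then have "(a, Lower j) \<in> diagram_edges \<alpha>" by (rule E\<alpha>(3))
        moreover have "(a, d) \<in> diagram_edges \<alpha>" using right(3) c by simp
        ultimately have "Lower j = d" by (rule E\<alpha>(5))
        then show ?thesis using right(2) j by auto
      qed
    qed
  qed simp
  then show ?thesis by simp
qed

text \<open>
  A product path between two exit vertices is a path of \<open>\<xi>\<close> and the upper hooks of \<open>\<alpha>\<close>, prolonged by
  transversals of \<open>\<alpha>\<close>; the lower hooks of \<open>\<alpha>\<close> stay apart. Closure under multiplication, the right
  identity and the kernel of right multiplication by \<open>\<alpha>\<close> are all read off from this decomposition.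
\<close>

lemma product_edges_eq:
  "product_edges n \<xi> \<alpha> = map_prod (exit_vertex \<alpha>) (exit_vertex \<alpha>) `
     contraction (input_vertices n \<alpha>) (cap_edges \<alpha>) (diagram_edges \<xi>) \<union> cup_edges \<alpha>"
  (is "_ = ?R")
proof (intro equalityI subrelI)
  fix u v assume uv: "(u, v) \<in> product_edges n \<xi> \<alpha>"
  then have uv': "u \<in> diagram_vertices n" "v \<in> diagram_vertices n" "u \<noteq> v" 
    "(u, v) \<in> (product_graph \<xi> \<alpha>)\<^sup>*" "(v, u) \<in> (product_graph \<xi> \<alpha>)\<^sup>*"
    using symD[OF sym_product_graph] by (auto simp: product_edges_def)
  show "(u, v) \<in> ?R"
  proof (cases "u \<in> exit_vertex \<alpha> ` input_vertices n \<alpha> \<and> v \<in> exit_vertex \<alpha> ` input_vertices n \<alpha>")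
    case True
    then obtain x y where xy: "u = exit_vertex \<alpha> x" "x \<in> input_vertices n \<alpha>" "v = exit_vertex \<alpha> y" "y \<in> input_vertices n \<alpha>"
      by blast
    then have "(x, y) \<in> contraction (input_vertices n \<alpha>) (cap_edges \<alpha>) (diagram_edges \<xi>)"
      using uv' connected_exits_iff[OF xy(2,4)] by (auto simp: contraction_def)
    then show ?thesis using xy by force
  next
    case False
    then have "(u, v) \<in> cup_edges \<alpha> \<or> (v, u) \<in> cup_edges \<alpha>"
      using non_exit_reaches uv' by blast
    then show ?thesis using matchingsD(3)[OF cup_edges_matching] by blast
  qed
next
  fix u v assume "(u, v) \<in> ?R"
  then consider x y where "u = exit_vertex \<alpha> x" "v = exit_vertex \<alpha> y"
      "(x, y) \<in> contraction (input_vertices n \<alpha>) (cap_edges \<alpha>) (diagram_edges \<xi>)"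
    | "(u, v) \<in> cup_edges \<alpha>" by auto
  then show "(u, v) \<in> product_edges n \<xi> \<alpha>"
  proof cases
    case 1
    then have xy: "x \<in> input_vertices n \<alpha>" "y \<in> input_vertices n \<alpha>" "x \<noteq> y" "(x, y) \<in> (diagram_edges \<xi> \<union> cap_edges \<alpha>)\<^sup>*"
      by (auto simp: contraction_def)
    then have "u \<noteq> v" using 1 inj_on_exit by (auto dest: inj_onD)
    then show ?thesis using 1 xy connected_exits_iff[OF xy(1,2)] exit_in_vertices by (auto simp: product_edges_def)
  next
    case 2
    then have e: "(u, v) \<in> diagram_edges \<alpha>" and "(u, v) \<in> product_graph \<xi> \<alpha>"
      using product_graph_right by (force simp: cup_edges_def)+
    then show ?thesis using E\<alpha>(1,2)[OF e] E\<alpha>(4) by (auto simp: product_edges_def)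
  qed
qed

lemma product_edges_matching: "product_edges n \<xi> \<alpha> \<in> matchings (diagram_vertices n)"
proof -
  let ?C = "map_prod (exit_vertex \<alpha>) (exit_vertex \<alpha>) `
     contraction (input_vertices n \<alpha>) (cap_edges \<alpha>) (diagram_edges \<xi>)"
  let ?Y = "exit_vertex \<alpha> ` input_vertices n \<alpha>"
  have C: "?C \<in> matchings ?Y"
    by (rule map_matching[OF contraction_matching[OF diagram_edges_matching[OF \<xi>] cap_edges_matching] inj_on_exit]) simp
  have Y: "?Y \<subseteq> diagram_vertices n" using exit_in_vertices by blast
  show ?thesis
    unfolding product_edges_eq by (rule matchings_union[OF C cup_edges_matching Y])
qed

lemma diagram_edges_mult: "diagram_edges (diagram_mult n \<xi> \<alpha>) = product_edges n \<xi> \<alpha>"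
  unfolding diagram_mult_eq by (rule edges_matching_diagram[OF product_edges_matching])

lemma diagram_mult_closed: "diagram_mult n \<xi> \<alpha> \<in> partial_brauer_diagrams n"
  unfolding diagram_mult_eq by (rule matching_diagram_PB[OF product_edges_matching])

end

end

lemma diagram_mult_eq_iff_contraction:
  assumes \<xi>: "\<xi> \<in> partial_brauer_diagrams n" and \<eta>: "\<eta> \<in> partial_brauer_diagrams n"
    and \<alpha>: "\<alpha> \<in> partial_brauer_diagrams n"
  shows "diagram_mult n \<xi> \<alpha> = diagram_mult n \<eta> \<alpha> \<longleftrightarrow>
    contraction (input_vertices n \<alpha>) (cap_edges \<alpha>) (diagram_edges \<xi>) =
    contraction (input_vertices n \<alpha>) (cap_edges \<alpha>) (diagram_edges \<eta>)"
    (is "_ \<longleftrightarrow> ?C \<xi> = ?C \<eta>")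
proof
  let ?e = "map_prod (exit_vertex \<alpha>) (exit_vertex \<alpha>)" and ?I = "input_vertices n \<alpha>"
  have sub: "?C \<zeta> \<subseteq> ?I \<times> ?I" for \<zeta> by (auto simp: contraction_def)
  assume "diagram_mult n \<xi> \<alpha> = diagram_mult n \<eta> \<alpha>"
  then have "?e ` ?C \<xi> \<union> cup_edges \<alpha> = ?e ` ?C \<eta> \<union> cup_edges \<alpha>"
    using diagram_edges_mult[OF \<alpha> \<xi>] diagram_edges_mult[OF \<alpha> \<eta>]
      product_edges_eq[OF \<alpha> \<xi>] product_edges_eq[OF \<alpha> \<eta>] by simp
  moreover have "?e ` ?C \<zeta> \<inter> cup_edges \<alpha> = {}" for \<zeta>
    using matchingsD(1)[OF cup_edges_matching[OF \<alpha>]] sub by fastforce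
  ultimately have "?e ` ?C \<xi> = ?e ` ?C \<eta>" by blast
  then show "?C \<xi> = ?C \<eta>"
    using inj_on_image_eq_iff[OF map_prod_inj_on[OF inj_on_exit[OF \<alpha>] inj_on_exit[OF \<alpha>]] sub sub] by blast
next
  assume "?C \<xi> = ?C \<eta>"
  then show "diagram_mult n \<xi> \<alpha> = diagram_mult n \<eta> \<alpha>"
    unfolding diagram_mult_eq product_edges_eq[OF \<alpha> \<xi>] product_edges_eq[OF \<alpha> \<eta>] by simp
qed

definition identity_diagram :: "nat \<Rightarrow> diagram" where
  "identity_diagram n = (\<lambda>i. {Upper i, Lower i}) ` {1..n}"

lemma identity_diagram_PB: "identity_diagram n \<in> partial_brauer_diagrams n"
  unfolding partial_brauer_diagrams_def partition_on_def identity_diagram_def diagram_vertices_def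
  by (auto simp: disjoint_def)

lemma edges_identity_diagram:
  "diagram_edges (identity_diagram n) = (\<Union>i\<in>{1..n}. {(Upper i, Lower i), (Lower i, Upper i)})"
  by (auto simp: diagram_edges_def identity_diagram_def doubleton_eq_iff)

lemma diagram_mult_identity:
  assumes \<xi>: "\<xi> \<in> partial_brauer_diagrams n"
  shows "diagram_mult n \<xi> (identity_diagram n) = \<xi>"
proof -
  let ?\<iota> = "identity_diagram n" and ?V = "diagram_vertices n"
  have I: "input_vertices n ?\<iota> = ?V" 
    by (auto simp: input_vertices_def edges_identity_diagram diagram_vertices_def)
  have caps: "cap_edges ?\<iota> = {}" "cup_edges ?\<iota> = {}"
    by (auto simp: cap_edges_def cup_edges_def edges_identity_diagram)
  have e: "exit_vertex ?\<iota> v = v" if "v \<in> ?V" for v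
    using that exit_Lower[OF identity_diagram_PB]
    by (cases rule: diagram_vertices_cases) (auto simp: edges_identity_diagram)
  have M: "diagram_edges \<xi> \<in> matchings ?V" by (rule diagram_edges_matching[OF \<xi>])
  have "map_prod (exit_vertex ?\<iota>) (exit_vertex ?\<iota>) ` diagram_edges \<xi> = diagram_edges \<xi>"
  proof -
    have "map_prod (exit_vertex ?\<iota>) (exit_vertex ?\<iota>) e = e" if "e \<in> diagram_edges \<xi>" for e
      using that e matchingsD(1,2)[OF M] by (cases e) auto
    then show ?thesis by force
  qed
  then have "product_edges n \<xi> ?\<iota> = diagram_edges \<xi>"
    unfolding product_edges_eq[OF identity_diagram_PB \<xi>] I caps
    using contraction_of_matching[OF M empty_matching] by simp
  then show ?thesis unfolding diagram_mult_eq using matching_diagram_edges[OF \<xi>] by simp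
qed

section \<open>Associativity\<close>

text \<open>
  Every excursion of a path into the interior \<open>W\<close> uses edges of \<open>A\<close> only, so it may be replaced by a
  single edge that records the connection.
\<close>

lemma rtrancl_contract_interior:
  assumes B: "\<And>u v. (u, v) \<in> B \<Longrightarrow> u \<notin> W \<and> v \<notin> W" and xy: "x \<notin> W" "y \<notin> W"
  shows "(x, y) \<in> (A \<union> B)\<^sup>* \<longleftrightarrow>
    (x, y) \<in> ({(u, v). (u, v) \<in> A\<^sup>* \<and> u \<noteq> v \<and> u \<notin> W \<and> v \<notin> W} \<union> B)\<^sup>*"
    (is "_ \<longleftrightarrow> _ \<in> (?D \<union> B)\<^sup>*")
proof
  have D: "(x, w) \<in> (?D \<union> B)\<^sup>*" if "(x, v) \<in> (?D \<union> B)\<^sup>*" "(v, w) \<in> A\<^sup>*" "v \<notin> W" "w \<notin> W" for v w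
  proof (cases "v = w")
    case False
    then have "(v, w) \<in> ?D \<union> B" using that by blast
    then show ?thesis using that(1) by (rule rtrancl.rtrancl_into_rtrancl[rotated])
  qed (use that in simp)
  assume "(x, y) \<in> (A \<union> B)\<^sup>*"
  \<comment> \<open>a path is followed together with the last vertex at which it left the interior\<close>
  then have "\<exists>v. v \<notin> W \<and> (x, v) \<in> (?D \<union> B)\<^sup>* \<and> (v, y) \<in> A\<^sup>*"
  proof (induction rule: rtrancl_induct)
    case base then show ?case using xy by blast
  next
    case (step c d)
    then obtain v where v: "v \<notin> W" "(x, v) \<in> (?D \<union> B)\<^sup>*" "(v, c) \<in> A\<^sup>*" by blast
    show ?case
    proof (cases "(c, d) \<in> B")
      case True
      then have "(x, c) \<in> (?D \<union> B)\<^sup>*" using D v B by blast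
      then have "(x, d) \<in> (?D \<union> B)\<^sup>*"
        by (rule rtrancl.rtrancl_into_rtrancl) (use True in blast)
      then show ?thesis using B[OF True] by blast
    next
      case False
      then have "(v, d) \<in> A\<^sup>*" using v(3) step(2) by (auto intro: rtrancl.rtrancl_into_rtrancl)
      then show ?thesis using v by blast
    qed
  qed
  then show "(x, y) \<in> (?D \<union> B)\<^sup>*" using D xy by blast
next
  assume "(x, y) \<in> (?D \<union> B)\<^sup>*"
  then show "(x, y) \<in> (A \<union> B)\<^sup>*"
  proof (induction rule: rtrancl_induct)
    case (step c d)
    have "(c, d) \<in> (A \<union> B)\<^sup>*"
      using step(2) rtrancl_mono[of A "A \<union> B"] by auto
    then show ?case using step(3) by (rule rtrancl_trans[rotated])
  qed simp
qed

lemma rtrancl_image_inj: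
  assumes f: "inj f"
  shows "(f x, w) \<in> (map_prod f f ` R)\<^sup>* \<longleftrightarrow> (\<exists>y. w = f y \<and> (x, y) \<in> R\<^sup>*)"
proof
  assume con: "(f x, w) \<in> (map_prod f f ` R)\<^sup>*"
  have "w \<in> f ` {y. (x, y) \<in> R\<^sup>*}"
    by (rule closed_rtrancl[OF con])
      (auto dest!: injD[OF f] intro: rtrancl.rtrancl_into_rtrancl)
  then show "\<exists>y. w = f y \<and> (x, y) \<in> R\<^sup>*" by auto
next
  assume "\<exists>y. w = f y \<and> (x, y) \<in> R\<^sup>*"
  then obtain y where y: "w = f y" "(x, y) \<in> R\<^sup>*" by blast
  from y(2) have "(f x, f y) \<in> (map_prod f f ` R)\<^sup>*"
  proof (induction rule: rtrancl_induct)
    case (step c d)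
    have "(f c, f d) \<in> map_prod f f ` R" using step(2) by force
    with step(3) show ?case by (rule rtrancl.rtrancl_into_rtrancl)
  qed simp
  then show "(f x, w) \<in> (map_prod f f ` R)\<^sup>*" using y(1) by simp
qed

text \<open>
  To compare both bracketings of a triple product, its diagrams are drawn between four consecutive
  rows; \<open>(a, i)\<close> is the point \<open>i\<close> in row \<open>a\<close>.
\<close>

fun place :: "nat \<Rightarrow> nat \<Rightarrow> nat \<Rightarrow> vertex \<Rightarrow> nat \<times> nat" where
  "place a b c (Upper i) = (a, i)"
| "place a b c (Middle i) = (b, i)"
| "place a b c (Lower i) = (c, i)"

definition layer :: "nat \<Rightarrow> nat \<Rightarrow> diagram \<Rightarrow> (nat \<times> nat) rel" where
  "layer a c \<alpha> = map_prod (place a a c) (place a a c) ` diagram_edges \<alpha>"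

lemma inj_place: "a \<noteq> b \<Longrightarrow> b \<noteq> c \<Longrightarrow> a \<noteq> c \<Longrightarrow> inj (place a b c)"
  by (rule injI, rename_tac x y, case_tac x; case_tac y) auto

lemma place_outer_vertex: "v \<in> diagram_vertices n \<Longrightarrow> place a b c v = place a d c v"
  by (auto simp: diagram_vertices_def)

lemma map_product_graph:
  assumes "\<And>u v. (u, v) \<in> diagram_edges \<alpha> \<Longrightarrow> f (lower_to_middle u) = g u \<and> f (lower_to_middle v) = g v"
    and "\<And>u v. (u, v) \<in> diagram_edges \<beta> \<Longrightarrow> f (upper_to_middle u) = h u \<and> f (upper_to_middle v) = h v"
  shows "map_prod f f ` product_graph \<alpha> \<beta> = map_prod g g ` diagram_edges \<alpha> \<union> map_prod h h ` diagram_edges \<beta>"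
  unfolding product_graph_def image_Un image_image
  by (intro arg_cong2[of _ _ _ _ "(\<union>)"] image_cong) (use assms in auto)

lemma place_product_graph:
  assumes \<alpha>: "\<alpha> \<in> partial_brauer_diagrams n" and \<beta>: "\<beta> \<in> partial_brauer_diagrams n"
  shows "map_prod (place a b c) (place a b c) ` product_graph \<alpha> \<beta> = layer a b \<alpha> \<union> layer b c \<beta>"
proof -
  have "place a b c (lower_to_middle v) = place a a b v" "place a b c (upper_to_middle v) = place b b c v"
    if "v \<in> diagram_vertices n" for v
    using that by (auto simp: diagram_vertices_def)
  then show ?thesis
    unfolding layer_def
    using matchingsD(1,2)[OF diagram_edges_matching[OF \<alpha>]] matchingsD(1,2)[OF diagram_edges_matching[OF \<beta>]]
    by (intro map_product_graph) blast+
qed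

lemma place_connected_iff:
  assumes "\<alpha> \<in> partial_brauer_diagrams n" "\<beta> \<in> partial_brauer_diagrams n"
    and "a \<noteq> b" "b \<noteq> c" "a \<noteq> c"
  shows "(place a b c u, place a b c v) \<in> (layer a b \<alpha> \<union> layer b c \<beta>)\<^sup>* \<longleftrightarrow>
    (u, v) \<in> (product_graph \<alpha> \<beta>)\<^sup>*"
  unfolding place_product_graph[OF assms(1,2), symmetric] rtrancl_image_inj[OF inj_place[OF assms(3-5)]]
  using inj_place[OF assms(3-5)] by (auto dest: injD)

lemma layer_vertices:
  assumes "\<alpha> \<in> partial_brauer_diagrams n" "(u, v) \<in> layer a c \<alpha>"
  shows "u \<in> {a, c} \<times> {1..n}" "v \<in> {a, c} \<times> {1..n}"
  using assms(2) matchingsD(1,2)[OF diagram_edges_matching[OF assms(1)]]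
  by (fastforce simp: layer_def diagram_vertices_def)+

text \<open>
  The product of two diagrams is the graph of two adjacent layers with the row between them
  contracted, in the form that the lemma on contracting an interior expects.
\<close>

lemma layer_diagram_mult:
  assumes \<alpha>: "\<alpha> \<in> partial_brauer_diagrams n" and \<beta>: "\<beta> \<in> partial_brauer_diagrams n"
    and abc: "a \<noteq> b" "b \<noteq> c" "a \<noteq> c"
  shows "layer a c (diagram_mult n \<alpha> \<beta>) = {(x, y). (x, y) \<in> (layer a b \<alpha> \<union> layer b c \<beta>)\<^sup>* \<and> x \<noteq> y \<and>
    x \<notin> {z. fst z = b} \<and> y \<notin> {z. fst z = b}}" (is "_ = ?R")
proof (intro equalityI subrelI)
  note inj = inj_place[OF abc]
  have mid: "place a a c v = place a b c v" if "v \<in> diagram_vertices n" for v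
    using that by (rule place_outer_vertex)
  fix x y assume "(x, y) \<in> layer a c (diagram_mult n \<alpha> \<beta>)"
  then obtain u v where uv: "(u, v) \<in> product_edges n \<alpha> \<beta>" "x = place a a c u" "y = place a a c v"
    by (auto simp: layer_def diagram_edges_mult[OF \<beta> \<alpha>])
  then have V: "u \<in> diagram_vertices n" "v \<in> diagram_vertices n" "u \<noteq> v" "(u, v) \<in> (product_graph \<alpha> \<beta>)\<^sup>*"
    by (auto simp: product_edges_def)
  then have "(x, y) \<in> (layer a b \<alpha> \<union> layer b c \<beta>)\<^sup>*" "x \<noteq> y"
    using uv mid place_connected_iff[OF \<alpha> \<beta> abc, of u v] inj by (auto dest: injD)
  moreover have "fst x \<noteq> b" "fst y \<noteq> b"
    using V uv abc by (auto simp: diagram_vertices_def)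
  ultimately show "(x, y) \<in> ?R" by simp
next
  fix x y assume xy: "(x, y) \<in> ?R"
  let ?G = "layer a b \<alpha> \<union> layer b c \<beta>"
  have con: "(x, y) \<in> ?G\<^sup>*" and neq: "x \<noteq> y" "fst x \<noteq> b" "fst y \<noteq> b" using xy by auto
  obtain x' y' where "(x, x') \<in> ?G" "(y', y) \<in> ?G"
    using con neq(1) by (metis converse_rtranclE rtranclE)
  then have "x \<in> {a, b, c} \<times> {1..n}" "y \<in> {a, b, c} \<times> {1..n}"
    using layer_vertices[OF \<alpha>] layer_vertices[OF \<beta>] by blast+
  then have x: "x \<in> {a, c} \<times> {1..n}" and y: "y \<in> {a, c} \<times> {1..n}"
    using neq(2,3) by auto
  have ex: "\<exists>u\<in>diagram_vertices n. z = place a b c u \<and> z = place a a c u" if "z \<in> {a, c} \<times> {1..n}" for z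
  proof -
    from that obtain i where "i \<in> {1..n}" "z = (a, i) \<or> z = (c, i)" by auto
    then have "Upper i \<in> diagram_vertices n" "Lower i \<in> diagram_vertices n"
      "z = place a b c (Upper i) \<and> z = place a a c (Upper i) \<or> z = place a b c (Lower i) \<and> z = place a a c (Lower i)"
      by (auto simp: diagram_vertices_def)
    then show ?thesis by blast
  qed
  obtain u where u: "u \<in> diagram_vertices n" "x = place a b c u" "x = place a a c u"
    using ex[OF x] by blast
  obtain v where v: "v \<in> diagram_vertices n" "y = place a b c v" "y = place a a c v"
    using ex[OF y] by blast
  have "(u, v) \<in> product_edges n \<alpha> \<beta>"
    using con neq(1) u v place_connected_iff[OF \<alpha> \<beta> abc, of u v] by (auto simp: product_edges_def)
  then have "map_prod (place a a c) (place a a c) (u, v) \<in> layer a c (diagram_mult n \<alpha> \<beta>)"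
    unfolding layer_def diagram_edges_mult[OF \<beta> \<alpha>] by (rule imageI)
  then show "(x, y) \<in> layer a c (diagram_mult n \<alpha> \<beta>)" using u(3) v(3) by simp
qed

text \<open>
  Both products are the connectivity of the outer rows in the graph of all three layers: contract
  row 1 for one bracketing and row 2 for the other.
\<close>

lemma diagram_mult_assoc:
  assumes \<alpha>: "\<alpha> \<in> partial_brauer_diagrams n" and \<beta>: "\<beta> \<in> partial_brauer_diagrams n"
    and \<gamma>: "\<gamma> \<in> partial_brauer_diagrams n"
  shows "diagram_mult n (diagram_mult n \<alpha> \<beta>) \<gamma> = diagram_mult n \<alpha> (diagram_mult n \<beta> \<gamma>)"
proof -
  let ?L = "layer 0 1 \<alpha> \<union> layer 1 2 \<beta> \<union> layer 2 3 \<gamma>"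
  have ab: "diagram_mult n \<alpha> \<beta> \<in> partial_brauer_diagrams n" 
    and bc: "diagram_mult n \<beta> \<gamma> \<in> partial_brauer_diagrams n"
    using diagram_mult_closed \<alpha> \<beta> \<gamma> by blast+
  have "(u, v) \<in> (product_graph (diagram_mult n \<alpha> \<beta>) \<gamma>)\<^sup>* \<longleftrightarrow>
      (u, v) \<in> (product_graph \<alpha> (diagram_mult n \<beta> \<gamma>))\<^sup>*"
    if uv: "u \<in> diagram_vertices n" "v \<in> diagram_vertices n" for u v
  proof -
    let ?p = "place 0 2 3" and ?q = "place 0 1 3"
    have pq: "?p u = ?q u" "?p v = ?q v" using uv place_outer_vertex by blast+
    have out1: "?q u \<notin> {z. fst z = 1}" "?q v \<notin> {z. fst z = 1}"
      and out2: "?q u \<notin> {z. fst z = 2}" "?q v \<notin> {z. fst z = 2}"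
      using uv by (auto simp: diagram_vertices_def)
    have outer: "x \<notin> {z. fst z = b} \<and> y \<notin> {z. fst z = b}"
      if "(x, y) \<in> layer a c \<delta>" "b \<noteq> a" "b \<noteq> c" "\<delta> \<in> partial_brauer_diagrams n" for a b c \<delta> x y
      using layer_vertices[OF that(4,1)] that(2,3) by auto
    have "(u, v) \<in> (product_graph (diagram_mult n \<alpha> \<beta>) \<gamma>)\<^sup>* \<longleftrightarrow>
        (?q u, ?q v) \<in> (layer 0 2 (diagram_mult n \<alpha> \<beta>) \<union> layer 2 3 \<gamma>)\<^sup>*"
      using place_connected_iff[OF ab \<gamma>, of 0 2 3 u v] pq by simp
    also have "layer 0 2 (diagram_mult n \<alpha> \<beta>) = {(x, y). (x, y) \<in> (layer 0 1 \<alpha> \<union> layer 1 2 \<beta>)\<^sup>* \<and> x \<noteq> y \<and>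
        x \<notin> {z. fst z = 1} \<and> y \<notin> {z. fst z = 1}}"
      by (rule layer_diagram_mult[OF \<alpha> \<beta>]) auto
    also have "(?q u, ?q v) \<in> (\<dots> \<union> layer 2 3 \<gamma>)\<^sup>* \<longleftrightarrow> (?q u, ?q v) \<in> ?L\<^sup>*"
      by (rule rtrancl_contract_interior[OF _ out1, symmetric], erule outer) (simp_all add: \<gamma>)
    also have "?L = (layer 1 2 \<beta> \<union> layer 2 3 \<gamma>) \<union> layer 0 1 \<alpha>" by blast
    also have "(?q u, ?q v) \<in> \<dots>\<^sup>* \<longleftrightarrow> (?q u, ?q v) \<in> ({(x, y). (x, y) \<in> (layer 1 2 \<beta> \<union> layer 2 3 \<gamma>)\<^sup>* \<and> x \<noteq> y \<and>
        x \<notin> {z. fst z = 2} \<and> y \<notin> {z. fst z = 2}} \<union> layer 0 1 \<alpha>)\<^sup>*"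
      by (rule rtrancl_contract_interior[OF _ out2], erule outer) (simp_all add: \<alpha>)
    also have "{(x, y). (x, y) \<in> (layer 1 2 \<beta> \<union> layer 2 3 \<gamma>)\<^sup>* \<and> x \<noteq> y \<and>
        x \<notin> {z. fst z = 2} \<and> y \<notin> {z. fst z = 2}} = layer 1 3 (diagram_mult n \<beta> \<gamma>)"
      by (rule layer_diagram_mult[OF \<beta> \<gamma>, symmetric]) auto
    also have "(?q u, ?q v) \<in> (layer 1 3 (diagram_mult n \<beta> \<gamma>) \<union> layer 0 1 \<alpha>)\<^sup>* \<longleftrightarrow> 
        (u, v) \<in> (product_graph \<alpha> (diagram_mult n \<beta> \<gamma>))\<^sup>*"
      using place_connected_iff[OF \<alpha> bc, of 0 1 3 u v] by (simp add: Un_commute)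
    finally show ?thesis .
  qed
  then have "product_edges n (diagram_mult n \<alpha> \<beta>) \<gamma> = product_edges n \<alpha> (diagram_mult n \<beta> \<gamma>)"
    unfolding product_edges_def by blast
  then show ?thesis using diagram_mult_eq by metis
qed

section \<open>Renaming the vertices of diagrams\<close>

lemma matching_diagram_image:
  assumes \<rho>: "inj \<rho>" "\<rho> ` diagram_vertices n = diagram_vertices n"
  shows "matching_diagram n (map_prod \<rho> \<rho> ` M) = (`) \<rho> ` matching_diagram n M"
proof -
  have "{{u, v} | u v. (u, v) \<in> map_prod \<rho> \<rho> ` M} = (`) \<rho> ` {{u, v} | u v. (u, v) \<in> M}"
  proof -
    have "{{u, v} | u v. (u, v) \<in> N} = (\<lambda>e. {fst e, snd e}) ` N" for N :: "vertex rel"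
    proof -
      have "{{u, v} | u v. (u, v) \<in> N} = {{fst e, snd e} | e. e \<in> N}"
        by (metis (no_types, opaque_lifting) fst_conv snd_conv surj_pair)
      then show ?thesis by (simp only: Setcompr_eq_image Collect_mem_eq)
    qed
    then show ?thesis by (simp add: image_image)
  qed
  moreover have "Domain (map_prod \<rho> \<rho> ` M) = \<rho> ` Domain M"
    by (simp add: Domain_fst image_image)
  then have "diagram_vertices n - Domain (map_prod \<rho> \<rho> ` M) = \<rho> ` (diagram_vertices n - Domain M)"
    using image_set_diff[OF \<rho>(1)] \<rho>(2) by metis
  then have "{{u} | u. u \<in> diagram_vertices n - Domain (map_prod \<rho> \<rho> ` M)} =
      (`) \<rho> ` {{u} | u. u \<in> diagram_vertices n - Domain M}" by auto
  ultimately show ?thesis unfolding matching_diagram_def image_Un by simp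
qed

lemma diagram_edges_image:
  assumes \<rho>: "inj \<rho>"
  shows "diagram_edges ((`) \<rho> ` \<alpha>) = map_prod \<rho> \<rho> ` diagram_edges \<alpha>"
proof (intro equalityI subrelI)
  fix u v assume "(u, v) \<in> diagram_edges ((`) \<rho> ` \<alpha>)"
  then obtain B where B: "B \<in> \<alpha>" "{u, v} = \<rho> ` B" "u \<noteq> v" by (auto simp: diagram_edges_def)
  then obtain a b where ab: "u = \<rho> a" "v = \<rho> b" by blast
  have "\<rho> ` {a, b} = {u, v}" by (simp add: ab)
  also note B(2)
  finally have "\<rho> ` {a, b} = \<rho> ` B" .
  then have "{a, b} = B" by (rule inj_image_eq_iff[OF \<rho>, THEN iffD1])
  moreover have "a \<noteq> b" using B(3) ab by auto
  ultimately have "(a, b) \<in> diagram_edges \<alpha>" using B(1) by (simp add: diagram_edges_def)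
  then have "map_prod \<rho> \<rho> (a, b) \<in> map_prod \<rho> \<rho> ` diagram_edges \<alpha>" by (rule imageI)
  then show "(u, v) \<in> map_prod \<rho> \<rho> ` diagram_edges \<alpha>" using ab by simp
next
  fix u v assume "(u, v) \<in> map_prod \<rho> \<rho> ` diagram_edges \<alpha>"
  then obtain a b where ab: "u = \<rho> a" "v = \<rho> b" "a \<noteq> b" "{a, b} \<in> \<alpha>" by (auto simp: diagram_edges_def)
  have "u \<noteq> v" using ab(1-3) by (simp add: inj_eq[OF \<rho>])
  moreover have "\<rho> ` {a, b} = {u, v}" using ab(1,2) by simp
  then have "{u, v} \<in> (`) \<rho> ` \<alpha>" using imageI[OF ab(4), of "(`) \<rho>"] by simp
  ultimately show "(u, v) \<in> diagram_edges ((`) \<rho> ` \<alpha>)" by (simp add: diagram_edges_def)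
qed

lemma image_diagram_PB:
  assumes \<rho>: "inj \<rho>" "\<rho> ` diagram_vertices n = diagram_vertices n"
    and \<alpha>: "\<alpha> \<in> partial_brauer_diagrams n"
  shows "(`) \<rho> ` \<alpha> \<in> partial_brauer_diagrams n"
proof -
  have "(`) \<rho> ` \<alpha> = matching_diagram n (map_prod \<rho> \<rho> ` diagram_edges \<alpha>)"
    using matching_diagram_image[OF \<rho>] matching_diagram_edges[OF \<alpha>] by simp
  moreover have "map_prod \<rho> \<rho> ` diagram_edges \<alpha> \<in> matchings (diagram_vertices n)"
    by (rule map_matching[OF diagram_edges_matching[OF \<alpha>]]) (use \<rho> in \<open>auto intro: inj_on_subset\<close>)
  ultimately show ?thesis using matching_diagram_PB by simp
qed

lemma diagram_mult_image:
  assumes \<rho>: "inj \<rho>" "\<rho> ` diagram_vertices n = diagram_vertices n"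
    and G: "product_graph \<alpha>' \<beta>' = map_prod \<rho> \<rho> ` product_graph \<alpha> \<beta>"
  shows "diagram_mult n \<alpha>' \<beta>' = (`) \<rho> ` diagram_mult n \<alpha> \<beta>"
proof -
  have con: "(\<rho> u, \<rho> v) \<in> (product_graph \<alpha>' \<beta>')\<^sup>* \<longleftrightarrow> (u, v) \<in> (product_graph \<alpha> \<beta>)\<^sup>*" for u v
    unfolding G rtrancl_image_inj[OF \<rho>(1)] by (auto simp: inj_eq[OF \<rho>(1)])
  have V: "\<rho> u \<in> diagram_vertices n \<longleftrightarrow> u \<in> diagram_vertices n" for u
    using inj_image_mem_iff[OF \<rho>(1)] \<rho>(2) by metis
  have "product_edges n \<alpha>' \<beta>' = map_prod \<rho> \<rho> ` product_edges n \<alpha> \<beta>"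
  proof (intro equalityI subrelI)
    fix x y assume xy: "(x, y) \<in> product_edges n \<alpha>' \<beta>'"
    then have "x \<in> \<rho> ` diagram_vertices n" "y \<in> \<rho> ` diagram_vertices n"
      unfolding \<rho>(2) by (auto simp: product_edges_def)
    then obtain u v where uv: "x = \<rho> u" "y = \<rho> v" by blast
    then have "(u, v) \<in> product_edges n \<alpha> \<beta>" using xy con V by (auto simp: product_edges_def)
    then show "(x, y) \<in> map_prod \<rho> \<rho> ` product_edges n \<alpha> \<beta>" using uv by force
  next
    fix x y assume "(x, y) \<in> map_prod \<rho> \<rho> ` product_edges n \<alpha> \<beta>"
    then obtain u v where "x = \<rho> u" "y = \<rho> v" "(u, v) \<in> product_edges n \<alpha> \<beta>" by auto
    then show "(x, y) \<in> product_edges n \<alpha>' \<beta>'"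
      using con V by (auto simp: product_edges_def inj_eq[OF \<rho>(1)])
  qed
  then show ?thesis unfolding diagram_mult_eq by (simp add: matching_diagram_image[OF \<rho>])
qed

fun flip_vertex :: "vertex \<Rightarrow> vertex" where
  "flip_vertex (Upper i) = Lower i"
| "flip_vertex (Middle i) = Middle i"
| "flip_vertex (Lower i) = Upper i"

abbreviation flip_diagram :: "diagram \<Rightarrow> diagram" where
  "flip_diagram \<equiv> (`) ((`) flip_vertex)"

lemma flip_flip_vertex: "flip_vertex (flip_vertex v) = v"
  by (cases v) auto

lemma inj_flip_vertex: "inj flip_vertex"
  by (metis injI flip_flip_vertex)

lemma flip_vertices: "flip_vertex ` diagram_vertices n = diagram_vertices n"
  unfolding diagram_vertices_def image_Un image_image flip_vertex.simps by blast

lemma flip_flip_diagram: "flip_diagram (flip_diagram \<alpha>) = \<alpha>"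
  by (simp add: image_image flip_flip_vertex)

lemma flip_diagram_PB: "\<alpha> \<in> partial_brauer_diagrams n \<Longrightarrow> flip_diagram \<alpha> \<in> partial_brauer_diagrams n"
  by (rule image_diagram_PB[OF inj_flip_vertex flip_vertices])

lemma flip_diagram_mult: "flip_diagram (diagram_mult n \<alpha> \<beta>) = diagram_mult n (flip_diagram \<beta>) (flip_diagram \<alpha>)"
proof (rule diagram_mult_image[OF inj_flip_vertex flip_vertices, symmetric])
  have "flip_vertex (lower_to_middle u) = upper_to_middle (flip_vertex u)"
    "flip_vertex (upper_to_middle u) = lower_to_middle (flip_vertex u)" for u
    by (cases u; simp)+
  then have "map_prod flip_vertex flip_vertex ` product_graph \<alpha> \<beta> =
      map_prod (\<lambda>u. upper_to_middle (flip_vertex u)) (\<lambda>u. upper_to_middle (flip_vertex u)) ` diagram_edges \<alpha> \<union>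
      map_prod (\<lambda>u. lower_to_middle (flip_vertex u)) (\<lambda>u. lower_to_middle (flip_vertex u)) ` diagram_edges \<beta>"
    by (intro map_product_graph) auto
  also have "\<dots> = product_graph (flip_diagram \<beta>) (flip_diagram \<alpha>)"
    unfolding product_graph_def diagram_edges_image[OF inj_flip_vertex] image_image map_prod.comp comp_def
    by (auto simp: image_image map_prod_def split_beta)
  finally show "product_graph (flip_diagram \<beta>) (flip_diagram \<alpha>) = map_prod flip_vertex flip_vertex ` product_graph \<alpha> \<beta>" ..
qed

fun relabel_vertex :: "(nat \<Rightarrow> nat) \<Rightarrow> (nat \<Rightarrow> nat) \<Rightarrow> (nat \<Rightarrow> nat) \<Rightarrow> vertex \<Rightarrow> vertex" where
  "relabel_vertex f h g (Upper i) = Upper (f i)"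
| "relabel_vertex f h g (Middle i) = Middle (h i)"
| "relabel_vertex f h g (Lower i) = Lower (g i)"

abbreviation relabel_diagram :: "(nat \<Rightarrow> nat) \<Rightarrow> (nat \<Rightarrow> nat) \<Rightarrow> diagram \<Rightarrow> diagram" where
  "relabel_diagram f g \<equiv> (`) ((`) (relabel_vertex f id g))"

lemma inj_relabel_vertex: "inj f \<Longrightarrow> inj h \<Longrightarrow> inj g \<Longrightarrow> inj (relabel_vertex f h g)"
  by (rule injI, rename_tac x y, case_tac x; case_tac y) (auto dest: injD)

lemma relabel_vertices:
  assumes "f permutes {1..n}" "g permutes {1..n}"
  shows "relabel_vertex f h g ` diagram_vertices n = diagram_vertices n"
proof -
  have "relabel_vertex f h g ` diagram_vertices n = Upper ` f ` {1..n} \<union> Lower ` g ` {1..n}"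
    unfolding diagram_vertices_def image_Un image_image by simp
  then show ?thesis using assms by (simp add: permutes_image diagram_vertices_def)
qed

text \<open>
  The lower points of the left factor and the upper points of the right factor are glued, so both
  must be renamed by the same \<open>h\<close>, which disappears from the product.
\<close>

lemma relabel_diagram_mult:
  assumes \<alpha>: "\<alpha> \<in> partial_brauer_diagrams n" and \<beta>: "\<beta> \<in> partial_brauer_diagrams n"
    and f: "f permutes {1..n}" and h: "h permutes {1..n}" and g: "g permutes {1..n}"
  shows "relabel_diagram f g (diagram_mult n \<alpha> \<beta>) = diagram_mult n (relabel_diagram f h \<alpha>) (relabel_diagram h g \<beta>)"
proof -
  note inj = f[THEN permutes_inj] h[THEN permutes_inj] g[THEN permutes_inj]
  let ?\<rho> = "relabel_vertex f h g"
  have \<rho>: "inj ?\<rho>" "?\<rho> ` diagram_vertices n = diagram_vertices n"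
    using inj_relabel_vertex[OF inj] relabel_vertices[OF f g] by auto
  have lm: "?\<rho> (lower_to_middle u) = lower_to_middle (relabel_vertex f id h u)"
    "?\<rho> (upper_to_middle u) = upper_to_middle (relabel_vertex h id g u)"
    if "u \<in> diagram_vertices n" for u
    using that by (cases rule: diagram_vertices_cases; simp)+
  have "map_prod ?\<rho> ?\<rho> ` product_graph \<alpha> \<beta> =
      map_prod (\<lambda>u. lower_to_middle (relabel_vertex f id h u)) (\<lambda>u. lower_to_middle (relabel_vertex f id h u)) ` diagram_edges \<alpha> \<union>
      map_prod (\<lambda>u. upper_to_middle (relabel_vertex h id g u)) (\<lambda>u. upper_to_middle (relabel_vertex h id g u)) ` diagram_edges \<beta>"
    using lm matchingsD(1,2)[OF diagram_edges_matching[OF \<alpha>]] matchingsD(1,2)[OF diagram_edges_matching[OF \<beta>]]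
    by (intro map_product_graph) blast+
  also have "\<dots> = product_graph (relabel_diagram f h \<alpha>) (relabel_diagram h g \<beta>)"
    unfolding product_graph_def diagram_edges_image[OF inj_relabel_vertex[OF inj(1) inj_on_id inj(2)]]
      diagram_edges_image[OF inj_relabel_vertex[OF inj(2) inj_on_id inj(3)]]
    by (auto simp: image_image map_prod_def split_beta)
  finally have "diagram_mult n (relabel_diagram f h \<alpha>) (relabel_diagram h g \<beta>) = (`) ?\<rho> ` diagram_mult n \<alpha> \<beta>"
    by (intro diagram_mult_image[OF \<rho>]) simp
  also have "\<dots> = relabel_diagram f g (diagram_mult n \<alpha> \<beta>)"
  proof (rule image_cong[OF refl])
    fix B assume "B \<in> diagram_mult n \<alpha> \<beta>"
    then have "B \<subseteq> diagram_vertices n"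
      using diagram_mult_closed[OF \<beta> \<alpha>] by (auto simp: partial_brauer_diagrams_def partition_on_def)
    moreover have "?\<rho> v = relabel_vertex f id g v" if "v \<in> diagram_vertices n" for v
      using that by (cases rule: diagram_vertices_cases) auto
    ultimately show "?\<rho> ` B = relabel_vertex f id g ` B" by (intro image_cong) auto
  qed
  finally show ?thesis ..
qed

section \<open>The parameters of a diagram\<close>

definition upper_hooks :: "diagram \<Rightarrow> nat rel" where
  "upper_hooks \<alpha> = {(i, j). (Upper i, Upper j) \<in> diagram_edges \<alpha>}"

definition transversal_tops :: "diagram \<Rightarrow> nat set" where
  "transversal_tops \<alpha> = {i. \<exists>j. (Upper i, Lower j) \<in> diagram_edges \<alpha>}"

lemma same_block_iff:
  assumes "\<alpha> \<in> partial_brauer_diagrams n"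
  shows "(\<exists>B\<in>\<alpha>. u \<in> B \<and> v \<in> B) \<longleftrightarrow> u \<in> diagram_vertices n \<and> u = v \<or> (u, v) \<in> diagram_edges \<alpha>"
proof
  assume "\<exists>B\<in>\<alpha>. u \<in> B \<and> v \<in> B"
  then obtain B where "B \<in> matching_diagram n (diagram_edges \<alpha>)" "u \<in> B" "v \<in> B"
    using matching_diagram_edges[OF assms] by auto
  then show "u \<in> diagram_vertices n \<and> u = v \<or> (u, v) \<in> diagram_edges \<alpha>"
    using matchingsD(1,2,3)[OF diagram_edges_matching[OF assms]] unfolding matching_diagram_def by auto
next
  have cover: "\<Union> \<alpha> = diagram_vertices n" 
    using assms by (auto simp: partial_brauer_diagrams_def partition_on_def)
  assume "u \<in> diagram_vertices n \<and> u = v \<or> (u, v) \<in> diagram_edges \<alpha>"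
  then show "\<exists>B\<in>\<alpha>. u \<in> B \<and> v \<in> B"
  proof
    assume "(u, v) \<in> diagram_edges \<alpha>"
    then have "{u, v} \<in> \<alpha>" by (simp add: diagram_edges_def)
    then show ?thesis by blast
  qed (use cover in blast)
qed

lemma transversal_tops_subset:
  "\<alpha> \<in> partial_brauer_diagrams n \<Longrightarrow> transversal_tops \<alpha> \<subseteq> {1..n}"
  using matchingsD(1)[OF diagram_edges_matching] by (fastforce simp: transversal_tops_def diagram_vertices_def)

lemma upper_hooks_matching:
  assumes "\<alpha> \<in> partial_brauer_diagrams n"
  shows "upper_hooks \<alpha> \<in> matchings ({1..n} - transversal_tops \<alpha>)"
proof -
  note E = matchingsD[OF diagram_edges_matching[OF assms]]
  show ?thesis
  proof (rule matchingsI)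
    show "x \<in> {1..n} - transversal_tops \<alpha>" if "(x, y) \<in> upper_hooks \<alpha>" for x y
    proof -
      have e: "(Upper x, Upper y) \<in> diagram_edges \<alpha>" using that by (simp add: upper_hooks_def)
      have "x \<in> {1..n}" using E(1)[OF e] by (auto simp: diagram_vertices_def)
      moreover have "x \<notin> transversal_tops \<alpha>" using E(5)[OF e] by (auto simp: transversal_tops_def)
      ultimately show ?thesis by simp
    qed
    show "y = z" if "(x, y) \<in> upper_hooks \<alpha>" "(x, z) \<in> upper_hooks \<alpha>" for x y z
      using E(5)[of "Upper x" "Upper y" "Upper z"] that by (simp add: upper_hooks_def)
  qed (use E(3,4) in \<open>auto simp: upper_hooks_def\<close>)
qed

lemma diagram_rank_eq:
  assumes "\<alpha> \<in> partial_brauer_diagrams n"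
  shows "diagram_rank \<alpha> = card (transversal_tops \<alpha>)"
proof -
  note E = matchingsD[OF diagram_edges_matching[OF assms]]
  let ?b = "\<lambda>i. {Upper i, partner (diagram_edges \<alpha>) (Upper i)}"
  have b: "?b i = {Upper i, Lower j}" if "(Upper i, Lower j) \<in> diagram_edges \<alpha>" for i j
    using partner_eq[OF diagram_edges_matching[OF assms] that] by simp
  have "transversals \<alpha> = ?b ` transversal_tops \<alpha>"
  proof (intro equalityI subsetI)
    fix B assume "B \<in> transversals \<alpha>"
    then obtain i j where B: "B \<in> \<alpha>" "Upper i \<in> B" "Lower j \<in> B" by (auto simp: transversals_def)
    then have ij: "(Upper i, Lower j) \<in> diagram_edges \<alpha>" using same_block_iff[OF assms, of "Upper i" "Lower j"] by auto
    then have "{Upper i, Lower j} \<in> \<alpha>" by (simp add: diagram_edges_def)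
    moreover have "disjoint \<alpha>" using assms by (simp add: partial_brauer_diagrams_def partition_on_def)
    ultimately have "B = ?b i" using b[OF ij] B disjointD[of \<alpha> B "{Upper i, Lower j}"] by auto
    then show "B \<in> ?b ` transversal_tops \<alpha>" using ij by (auto simp: transversal_tops_def)
  next
    fix B assume "B \<in> ?b ` transversal_tops \<alpha>"
    then obtain i j where ij: "B = ?b i" "(Upper i, Lower j) \<in> diagram_edges \<alpha>" 
      by (auto simp: transversal_tops_def)
    then have "B = {Upper i, Lower j}" "{Upper i, Lower j} \<in> \<alpha>" using b by (auto simp: diagram_edges_def)
    then show "B \<in> transversals \<alpha>" by (auto simp: transversals_def)
  qed
  moreover have "inj_on ?b (transversal_tops \<alpha>)"
  proof (rule inj_onI)
    fix i i' assume ii: "i \<in> transversal_tops \<alpha>" "i' \<in> transversal_tops \<alpha>" "?b i = ?b i'"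
    then obtain j j' where "?b i = {Upper i, Lower j}" "?b i' = {Upper i', Lower j'}"
      using b unfolding transversal_tops_def by blast
    then have "{Upper i, Lower j} = {Upper i', Lower j'}" using ii(3) by simp
    then show "i = i'" by (auto simp: doubleton_eq_iff)
  qed
  ultimately show ?thesis by (simp add: diagram_rank_def card_image)
qed

text \<open>
  The remaining classes of the kernel are the upper hooks, and the symmetric relation
  \<open>upper_hooks \<alpha>\<close> has two pairs for each of them: as many as the hooks have points.
\<close>

lemma singleton_kernel_classes:
  assumes \<alpha>: "\<alpha> \<in> partial_brauer_diagrams n"
  shows "card (singleton_classes {1..n} (diagram_ker n \<alpha>)) + card (upper_hooks \<alpha>) = n"
proof -
  note H = matchingsD[OF upper_hooks_matching[OF \<alpha>]]
  let ?D = "Domain (upper_hooks \<alpha>)" and ?R = "diagram_ker n \<alpha>"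
  have ker: "?R `` {x} = insert x {y. (x, y) \<in> upper_hooks \<alpha>}" if "x \<in> {1..n}" for x
  proof -
    have "Upper x \<in> diagram_vertices n" using that by (auto simp: diagram_vertices_def)
    then have "(x, y) \<in> ?R \<longleftrightarrow> y = x \<or> (x, y) \<in> upper_hooks \<alpha>" for y
      using same_block_iff[OF \<alpha>, of "Upper x" "Upper y"] that H(2)
      by (auto simp: diagram_ker_def upper_hooks_def)
    then show ?thesis by auto
  qed
  have single: "is_singleton (?R `` {x}) \<longleftrightarrow> x \<notin> ?D" if x: "x \<in> {1..n}" for x
  proof
    assume "is_singleton (?R `` {x})"
    then obtain a where "insert x {y. (x, y) \<in> upper_hooks \<alpha>} = {a}"
      unfolding ker[OF x] by (rule is_singletonE)
    then have "y = x" if "(x, y) \<in> upper_hooks \<alpha>" for y using that by auto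
    then show "x \<notin> ?D" using H(4) by blast
  next
    assume "x \<notin> ?D"
    then have "?R `` {x} = {x}" unfolding ker[OF x] by auto
    then show "is_singleton (?R `` {x})" by simp
  qed
  have eq: "singleton_classes {1..n} ?R = (\<lambda>x. {x}) ` ({1..n} - ?D)"
  proof (intro equalityI subsetI)
    fix C assume "C \<in> singleton_classes {1..n} ?R"
    then obtain x where x: "x \<in> {1..n}" "C = ?R `` {x}" "is_singleton C"
      by (auto simp: singleton_classes_def quotient_def)
    then have "x \<notin> ?D" using single by simp
    moreover from this have "C = {x}" using x(2) ker[OF x(1)] by auto
    ultimately show "C \<in> (\<lambda>x. {x}) ` ({1..n} - ?D)" using x(1) by blast
  next
    fix C assume "C \<in> (\<lambda>x. {x}) ` ({1..n} - ?D)"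
    then obtain x where x: "x \<in> {1..n}" "x \<notin> ?D" "C = {x}" by blast
    then have "C = ?R `` {x}" using ker[OF x(1)] by auto
    then show "C \<in> singleton_classes {1..n} ?R"
      using x single[OF x(1)] by (auto simp: singleton_classes_def quotient_def)
  qed
  have D: "?D \<subseteq> {1..n}" using H(1) by blast
  have "card ?D = card (upper_hooks \<alpha>)"
    unfolding Domain_fst
    by (intro card_image inj_onI) (metis H(5) prod.collapse)
  moreover have "card (singleton_classes {1..n} ?R) = n - card ?D"
    unfolding eq using D by (simp add: card_image card_Diff_subset finite_subset[OF D])
  moreover have "card ?D \<le> n" using card_mono[OF _ D] by simp
  ultimately show ?thesis by simp
qed

lemma diagram_coker_flip: "diagram_coker n \<alpha> = diagram_ker n (flip_diagram \<alpha>)"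
proof -
  have "Upper x \<in> flip_vertex ` B \<longleftrightarrow> Lower x \<in> B" for x B
    using inj_image_mem_iff[OF inj_flip_vertex, of "Lower x" B] by simp
  then show ?thesis by (simp add: diagram_coker_def diagram_ker_def)
qed

lemma diagram_rank_flip: "diagram_rank (flip_diagram \<alpha>) = diagram_rank \<alpha>"
proof -
  have "Upper x \<in> flip_vertex ` B \<longleftrightarrow> Lower x \<in> B" "Lower x \<in> flip_vertex ` B \<longleftrightarrow> Upper x \<in> B" for x B
    using inj_image_mem_iff[OF inj_flip_vertex, of "Lower x" B] 
      inj_image_mem_iff[OF inj_flip_vertex, of "Upper x" B] by simp_all
  then have "transversals (flip_diagram \<alpha>) = (`) flip_vertex ` transversals \<alpha>"
    unfolding transversals_def Compr_image_eq by (simp only: conj_commute)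
  moreover have "inj_on ((`) flip_vertex) (transversals \<alpha>)"
    using inj_flip_vertex by (metis inj_onI inj_image_eq_iff)
  ultimately show ?thesis by (simp add: diagram_rank_def card_image)
qed

lemma card_cap_edges: "card (cap_edges \<alpha>) = card (upper_hooks \<alpha>)"
proof -
  have "cap_edges \<alpha> = map_prod Lower Lower ` upper_hooks \<alpha>"
    by (auto simp: cap_edges_def upper_hooks_def)
  moreover have "inj_on (map_prod Lower Lower) (upper_hooks \<alpha>)" by (auto simp: inj_on_def)
  ultimately show ?thesis by (simp add: card_image)
qed

lemma card_input_vertices:
  assumes "\<alpha> \<in> partial_brauer_diagrams n"
  shows "card (input_vertices n \<alpha>) = n + diagram_rank \<alpha>"
proof -
  have "input_vertices n \<alpha> = Upper ` {1..n} \<union> Lower ` transversal_tops \<alpha>"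
    by (auto simp: input_vertices_def transversal_tops_def)
  moreover have "finite (transversal_tops \<alpha>)"
    using finite_subset[OF transversal_tops_subset[OF assms]] by simp
  moreover have "Upper ` {1..n} \<inter> Lower ` transversal_tops \<alpha> = {}" by auto
  moreover have "card (Upper ` {1..n}) = n" "card (Lower ` transversal_tops \<alpha>) = card (transversal_tops \<alpha>)"
    by (simp_all add: card_image inj_on_def)
  ultimately show ?thesis by (simp add: card_Un_disjoint diagram_rank_eq[OF assms])
qed

section \<open>Isomorphic variants have the same parameters\<close>

lemma variant_simps [simp]:
  "carrier (variant (PB n) \<alpha>) = partial_brauer_diagrams n"
  "\<xi> \<otimes>\<^bsub>variant (PB n) \<alpha>\<^esub> \<eta> = diagram_mult n (diagram_mult n \<xi> \<alpha>) \<eta>"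
  by (simp_all add: variant_def PB_def)

lemma variant_isoE:
  assumes "variant (PB m) \<alpha> \<cong> variant (PB n) \<beta>"
  obtains \<phi> where "bij_betw \<phi> (partial_brauer_diagrams m) (partial_brauer_diagrams n)"
    "\<And>\<xi> \<eta>. \<xi> \<in> partial_brauer_diagrams m \<Longrightarrow> \<eta> \<in> partial_brauer_diagrams m \<Longrightarrow>
      \<phi> (diagram_mult m (diagram_mult m \<xi> \<alpha>) \<eta>) = diagram_mult n (diagram_mult n (\<phi> \<xi>) \<beta>) (\<phi> \<eta>)"
proof -
  obtain \<phi> where "\<phi> \<in> iso (variant (PB m) \<alpha>) (variant (PB n) \<beta>)"
    using assms by (auto simp: is_iso_def)
  then show thesis using that by (auto simp: iso_def hom_def)
qed

lemma variant_isoI: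
  assumes "bij_betw \<phi> (partial_brauer_diagrams m) (partial_brauer_diagrams n)"
    "\<And>\<xi> \<eta>. \<xi> \<in> partial_brauer_diagrams m \<Longrightarrow> \<eta> \<in> partial_brauer_diagrams m \<Longrightarrow>
      \<phi> (diagram_mult m (diagram_mult m \<xi> \<alpha>) \<eta>) = diagram_mult n (diagram_mult n (\<phi> \<xi>) \<beta>) (\<phi> \<eta>)"
  shows "variant (PB m) \<alpha> \<cong> variant (PB n) \<beta>"
proof -
  have "\<phi> \<in> iso (variant (PB m) \<alpha>) (variant (PB n) \<beta>)"
    using assms by (auto simp: iso_def hom_def bij_betw_def)
  then show ?thesis by (auto simp: is_iso_def)
qed

text \<open>
  Flipping reverses the order of a triple product, which changes its bracketing; associativity
  restores it.
\<close>

lemma variant_iso_flip: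
  assumes \<alpha>: "\<alpha> \<in> partial_brauer_diagrams m" and \<beta>: "\<beta> \<in> partial_brauer_diagrams n"
    and iso: "variant (PB m) \<alpha> \<cong> variant (PB n) \<beta>"
  shows "variant (PB m) (flip_diagram \<alpha>) \<cong> variant (PB n) (flip_diagram \<beta>)"
proof -
  obtain \<phi> where \<phi>: "bij_betw \<phi> (partial_brauer_diagrams m) (partial_brauer_diagrams n)"
    and hom: "\<And>\<xi> \<eta>. \<xi> \<in> partial_brauer_diagrams m \<Longrightarrow> \<eta> \<in> partial_brauer_diagrams m \<Longrightarrow>
      \<phi> (diagram_mult m (diagram_mult m \<xi> \<alpha>) \<eta>) = diagram_mult n (diagram_mult n (\<phi> \<xi>) \<beta>) (\<phi> \<eta>)"
    by (rule variant_isoE[OF iso]) (rule that, assumption, blast)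
  have flip: "bij_betw flip_diagram (partial_brauer_diagrams k) (partial_brauer_diagrams k)" for k
    by (rule bij_betw_byWitness[where f' = flip_diagram]) (auto simp: flip_flip_diagram flip_diagram_PB)
  have sandwich: "flip_diagram (diagram_mult k (diagram_mult k \<xi> \<gamma>) \<eta>) =
      diagram_mult k (diagram_mult k (flip_diagram \<eta>) (flip_diagram \<gamma>)) (flip_diagram \<xi>)"
    if "\<xi> \<in> partial_brauer_diagrams k" "\<gamma> \<in> partial_brauer_diagrams k" "\<eta> \<in> partial_brauer_diagrams k" for k \<xi> \<gamma> \<eta>
    using that by (simp add: flip_diagram_mult diagram_mult_assoc flip_diagram_PB)
  show ?thesis
  proof (rule variant_isoI)
    show "bij_betw (flip_diagram \<circ> \<phi> \<circ> flip_diagram) (partial_brauer_diagrams m) (partial_brauer_diagrams n)"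
      using flip \<phi> by (intro bij_betw_trans)
    fix \<xi> \<eta> assume "\<xi> \<in> partial_brauer_diagrams m" "\<eta> \<in> partial_brauer_diagrams m"
    then have f: "flip_diagram \<xi> \<in> partial_brauer_diagrams m" "flip_diagram \<eta> \<in> partial_brauer_diagrams m"
      and \<xi>\<eta>: "\<xi> \<in> partial_brauer_diagrams m" "\<eta> \<in> partial_brauer_diagrams m"
      using flip_diagram_PB by auto
    have \<phi>f: "\<phi> (flip_diagram \<xi>) \<in> partial_brauer_diagrams n" "\<phi> (flip_diagram \<eta>) \<in> partial_brauer_diagrams n"
      using f bij_betwE[OF \<phi>] by auto
    have "flip_diagram (\<phi> (flip_diagram (diagram_mult m (diagram_mult m \<xi> (flip_diagram \<alpha>)) \<eta>))) =
      flip_diagram (\<phi> (diagram_mult m (diagram_mult m (flip_diagram \<eta>) \<alpha>) (flip_diagram \<xi>)))"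
      using sandwich[OF \<xi>\<eta>(1) flip_diagram_PB[OF \<alpha>] \<xi>\<eta>(2)] by (simp only: flip_flip_diagram)
    also have "\<dots> = flip_diagram (diagram_mult n (diagram_mult n (\<phi> (flip_diagram \<eta>)) \<beta>) (\<phi> (flip_diagram \<xi>)))"
      by (simp only: hom[OF f(2,1)])
    also have "\<dots> = diagram_mult n (diagram_mult n (flip_diagram (\<phi> (flip_diagram \<xi>))) (flip_diagram \<beta>)) (flip_diagram (\<phi> (flip_diagram \<eta>)))"
      by (rule sandwich[OF \<phi>f(2) \<beta> \<phi>f(1)])
    finally show "(flip_diagram \<circ> \<phi> \<circ> flip_diagram) (diagram_mult m (diagram_mult m \<xi> (flip_diagram \<alpha>)) \<eta>) =
      diagram_mult n (diagram_mult n ((flip_diagram \<circ> \<phi> \<circ> flip_diagram) \<xi>) (flip_diagram \<beta>)) ((flip_diagram \<circ> \<phi> \<circ> flip_diagram) \<eta>)"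
      by (simp only: comp_def)
  qed
qed

text \<open>
  Having the same product with \<open>\<alpha>\<close> is expressible in the variant, since the identity diagram
  \<open>\<iota>\<close> gives \<open>\<xi>\<alpha> = \<xi> \<star> \<iota>\<close>. The isomorphism need not preserve the identity diagram, so each direction
  uses the identity of a different monoid.
\<close>

lemma variant_iso_kernel:
  assumes \<alpha>: "\<alpha> \<in> partial_brauer_diagrams m" and \<beta>: "\<beta> \<in> partial_brauer_diagrams n"
    and \<phi>: "bij_betw \<phi> (partial_brauer_diagrams m) (partial_brauer_diagrams n)"
    and hom: "\<And>\<xi> \<eta>. \<xi> \<in> partial_brauer_diagrams m \<Longrightarrow> \<eta> \<in> partial_brauer_diagrams m \<Longrightarrow>
      \<phi> (diagram_mult m (diagram_mult m \<xi> \<alpha>) \<eta>) = diagram_mult n (diagram_mult n (\<phi> \<xi>) \<beta>) (\<phi> \<eta>)"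
    and \<xi>: "\<xi> \<in> partial_brauer_diagrams m" and \<eta>: "\<eta> \<in> partial_brauer_diagrams m"
  shows "diagram_mult m \<xi> \<alpha> = diagram_mult m \<eta> \<alpha> \<longleftrightarrow> diagram_mult n (\<phi> \<xi>) \<beta> = diagram_mult n (\<phi> \<eta>) \<beta>"
proof
  have \<phi>PB: "\<phi> \<xi> \<in> partial_brauer_diagrams n" "\<phi> \<eta> \<in> partial_brauer_diagrams n"
    using \<xi> \<eta> bij_betwE[OF \<phi>] by auto
  {
    assume eq: "diagram_mult m \<xi> \<alpha> = diagram_mult m \<eta> \<alpha>"
    obtain \<iota> where \<iota>: "\<iota> \<in> partial_brauer_diagrams m" "\<phi> \<iota> = identity_diagram n"
      using \<phi> identity_diagram_PB[of n] unfolding bij_betw_def by (metis imageE)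
    have "diagram_mult n (diagram_mult n (\<phi> \<xi>) \<beta>) (\<phi> \<iota>) = diagram_mult n (diagram_mult n (\<phi> \<eta>) \<beta>) (\<phi> \<iota>)"
      using hom[OF \<xi> \<iota>(1)] hom[OF \<eta> \<iota>(1)] eq by simp
    then show "diagram_mult n (\<phi> \<xi>) \<beta> = diagram_mult n (\<phi> \<eta>) \<beta>"
      unfolding \<iota>(2) using diagram_mult_identity diagram_mult_closed[OF \<beta>] \<phi>PB by simp
  }
  assume eq: "diagram_mult n (\<phi> \<xi>) \<beta> = diagram_mult n (\<phi> \<eta>) \<beta>"
  let ?\<iota> = "identity_diagram m"
  have closed: "diagram_mult m \<xi> \<alpha> \<in> partial_brauer_diagrams m" "diagram_mult m \<eta> \<alpha> \<in> partial_brauer_diagrams m"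
    using diagram_mult_closed[OF \<alpha>] \<xi> \<eta> by auto
  have "\<phi> (diagram_mult m (diagram_mult m \<xi> \<alpha>) ?\<iota>) = \<phi> (diagram_mult m (diagram_mult m \<eta> \<alpha>) ?\<iota>)"
    using hom[OF \<xi> identity_diagram_PB] hom[OF \<eta> identity_diagram_PB] eq by simp
  then have "\<phi> (diagram_mult m \<xi> \<alpha>) = \<phi> (diagram_mult m \<eta> \<alpha>)"
    using closed by (simp add: diagram_mult_identity)
  then show "diagram_mult m \<xi> \<alpha> = diagram_mult m \<eta> \<alpha>"
    using \<phi> closed by (auto simp: bij_betw_def dest: inj_onD)
qed

lemma card_diagram_vertices: "card (diagram_vertices n) = 2 * n"
  unfolding diagram_vertices_def
  by (subst card_Un_disjoint) (auto simp: card_image inj_on_def)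

lemma variant_iso_invariants:
  assumes \<alpha>: "\<alpha> \<in> partial_brauer_diagrams m" and \<beta>: "\<beta> \<in> partial_brauer_diagrams n"
    and rank: "1 \<le> diagram_rank \<alpha>" "1 \<le> diagram_rank \<beta>"
    and iso: "variant (PB m) \<alpha> \<cong> variant (PB n) \<beta>"
  shows "m = n \<and> diagram_rank \<alpha> = diagram_rank \<beta> \<and> card (upper_hooks \<alpha>) = card (upper_hooks \<beta>)"
proof -
  obtain \<phi> where \<phi>: "bij_betw \<phi> (partial_brauer_diagrams m) (partial_brauer_diagrams n)"
    and hom: "\<And>\<xi> \<eta>. \<xi> \<in> partial_brauer_diagrams m \<Longrightarrow> \<eta> \<in> partial_brauer_diagrams m \<Longrightarrow>
      \<phi> (diagram_mult m (diagram_mult m \<xi> \<alpha>) \<eta>) = diagram_mult n (diagram_mult n (\<phi> \<xi>) \<beta>) (\<phi> \<eta>)"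
    by (rule variant_isoE[OF iso]) (rule that, assumption, blast)
  have "card (transversal_tops \<alpha>) \<le> m" "card (transversal_tops \<beta>) \<le> n"
    using card_mono[OF _ transversal_tops_subset[OF \<alpha>]] card_mono[OF _ transversal_tops_subset[OF \<beta>]] by auto
  then have pos: "1 \<le> m" "1 \<le> n" using rank diagram_rank_eq[OF \<alpha>] diagram_rank_eq[OF \<beta>] by auto
  have "card (matchings (diagram_vertices m)) = card (matchings (diagram_vertices n))"
    using bij_betw_same_card[OF bij_betw_diagram_edges] bij_betw_same_card[OF \<phi>] by metis
  then have "\<not> m < n" "\<not> n < m"
    using card_matchings_strict[OF finite_diagram_vertices, of "diagram_vertices m" n]
      card_matchings_strict[OF finite_diagram_vertices, of "diagram_vertices n" m] pos
    by (auto simp: card_diagram_vertices)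
  then have mn: "m = n" by simp
  define \<psi> where "\<psi> = diagram_edges \<circ> \<phi> \<circ> matching_diagram n"
  have md: "bij_betw (matching_diagram n) (matchings (diagram_vertices n)) (partial_brauer_diagrams n)"
    by (rule bij_betw_byWitness[where f' = diagram_edges])
      (auto simp: matching_diagram_edges edges_matching_diagram diagram_edges_matching matching_diagram_PB)
  have \<psi>: "bij_betw \<psi> (matchings (diagram_vertices n)) (matchings (diagram_vertices n))"
    unfolding \<psi>_def using md \<phi> bij_betw_diagram_edges mn by (metis bij_betw_trans)
  have ker: "contraction (input_vertices n \<alpha>) (cap_edges \<alpha>) M = contraction (input_vertices n \<alpha>) (cap_edges \<alpha>) N \<longleftrightarrow>
      contraction (input_vertices n \<beta>) (cap_edges \<beta>) (\<psi> M) = contraction (input_vertices n \<beta>) (cap_edges \<beta>) (\<psi> N)"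
    if MN: "M \<in> matchings (diagram_vertices n)" "N \<in> matchings (diagram_vertices n)" for M N
  proof -
    let ?\<xi> = "matching_diagram n M" and ?\<eta> = "matching_diagram n N"
    have PB: "?\<xi> \<in> partial_brauer_diagrams n" "?\<eta> \<in> partial_brauer_diagrams n"
      using MN matching_diagram_PB by auto
    then have \<phi>PB: "\<phi> ?\<xi> \<in> partial_brauer_diagrams n" "\<phi> ?\<eta> \<in> partial_brauer_diagrams n"
      using bij_betwE[OF \<phi>] mn by auto
    have \<alpha>': "\<alpha> \<in> partial_brauer_diagrams n" using \<alpha> mn by simp
    have "diagram_mult m ?\<xi> \<alpha> = diagram_mult m ?\<eta> \<alpha> \<longleftrightarrow> diagram_mult n (\<phi> ?\<xi>) \<beta> = diagram_mult n (\<phi> ?\<eta>) \<beta>"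
      by (rule variant_iso_kernel[OF \<alpha> \<beta> \<phi>], erule (1) hom) (use PB mn in simp_all)
    then show ?thesis
      using mn
        diagram_mult_eq_iff_contraction[OF PB \<alpha>'] diagram_mult_eq_iff_contraction[OF \<phi>PB \<beta>]
      by (simp add: \<psi>_def edges_matching_diagram MN)
  qed
  have \<alpha>n: "\<alpha> \<in> partial_brauer_diagrams n" using \<alpha> mn by simp
  have two: "2 \<le> card (input_vertices n \<alpha>)" "2 \<le> card (input_vertices n \<beta>)"
    using rank pos card_input_vertices[OF \<alpha>n] card_input_vertices[OF \<beta>] by auto
  note determines = contraction_kernel_determines[OF finite_diagram_vertices input_vertices_subset[OF \<alpha>n]
      input_vertices_subset[OF \<beta>] two cap_edges_matching[OF \<alpha>n] cap_edges_matching[OF \<beta>] \<psi>]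
  have det: "card (input_vertices n \<alpha>) = card (input_vertices n \<beta>)" "card (cap_edges \<alpha>) = card (cap_edges \<beta>)"
    by (rule determines, erule (1) ker)+
  show ?thesis
    using mn det card_input_vertices[OF \<alpha>n] card_input_vertices[OF \<beta>] by (simp add: card_cap_edges)
qed

section \<open>Diagrams with the same parameters are relabellings of each other\<close>

definition transversal_end :: "diagram \<Rightarrow> nat \<Rightarrow> nat" where
  "transversal_end \<alpha> i = (THE j. (Upper i, Lower j) \<in> diagram_edges \<alpha>)"

lemma transversal_end_eq:
  assumes "\<alpha> \<in> partial_brauer_diagrams n" "(Upper i, Lower j) \<in> diagram_edges \<alpha>"
  shows "transversal_end \<alpha> i = j"
  unfolding transversal_end_def
proof (rule the_equality)
  show "(Upper i, Lower j) \<in> diagram_edges \<alpha>" by (rule assms(2))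
  fix k assume "(Upper i, Lower k) \<in> diagram_edges \<alpha>"
  from matchingsD(5)[OF diagram_edges_matching[OF assms(1)] this assms(2)] show "k = j" by simp
qed

lemma transversal_end_edge:
  assumes "\<alpha> \<in> partial_brauer_diagrams n" "i \<in> transversal_tops \<alpha>"
  shows "(Upper i, Lower (transversal_end \<alpha> i)) \<in> diagram_edges \<alpha>"
  using assms transversal_end_eq unfolding transversal_tops_def by blast

lemma edges_flip: "(u, v) \<in> diagram_edges (flip_diagram \<alpha>) \<longleftrightarrow> (flip_vertex u, flip_vertex v) \<in> diagram_edges \<alpha>"
proof -
  have "(u, v) \<in> map_prod flip_vertex flip_vertex ` diagram_edges \<alpha> \<longleftrightarrow> (flip_vertex u, flip_vertex v) \<in> diagram_edges \<alpha>"
  proof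
    assume "(flip_vertex u, flip_vertex v) \<in> diagram_edges \<alpha>"
    from imageI[OF this, of "map_prod flip_vertex flip_vertex"]
    show "(u, v) \<in> map_prod flip_vertex flip_vertex ` diagram_edges \<alpha>" by (simp add: flip_flip_vertex)
  qed (auto simp: flip_flip_vertex)
  then show ?thesis by (simp add: diagram_edges_image[OF inj_flip_vertex])
qed

lemma bij_betw_transversal_end:
  assumes "\<alpha> \<in> partial_brauer_diagrams n"
  shows "bij_betw (transversal_end \<alpha>) (transversal_tops \<alpha>) (transversal_tops (flip_diagram \<alpha>))"
proof -
  note E = matchingsD[OF diagram_edges_matching[OF assms]]
  have bot: "j \<in> transversal_tops (flip_diagram \<alpha>) \<longleftrightarrow> (\<exists>i. (Lower j, Upper i) \<in> diagram_edges \<alpha>)" for j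
    by (simp add: transversal_tops_def edges_flip)
  have "inj_on (transversal_end \<alpha>) (transversal_tops \<alpha>)"
  proof (rule inj_onI)
    fix i i' assume "i \<in> transversal_tops \<alpha>" "i' \<in> transversal_tops \<alpha>" "transversal_end \<alpha> i = transversal_end \<alpha> i'"
    then have "(Lower (transversal_end \<alpha> i), Upper i) \<in> diagram_edges \<alpha>" "(Lower (transversal_end \<alpha> i), Upper i') \<in> diagram_edges \<alpha>"
      using transversal_end_edge[OF assms] E(3) by metis+
    then have "Upper i = Upper i'" by (rule E(5))
    then show "i = i'" by simp
  qed
  moreover have "transversal_end \<alpha> ` transversal_tops \<alpha> = transversal_tops (flip_diagram \<alpha>)"
  proof (intro equalityI subsetI)
    fix j assume "j \<in> transversal_end \<alpha> ` transversal_tops \<alpha>"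
    then show "j \<in> transversal_tops (flip_diagram \<alpha>)" using transversal_end_edge[OF assms] E(3) bot by blast
  next
    fix j assume "j \<in> transversal_tops (flip_diagram \<alpha>)"
    then obtain i where "(Upper i, Lower j) \<in> diagram_edges \<alpha>" using bot E(3) by blast
    then show "j \<in> transversal_end \<alpha> ` transversal_tops \<alpha>"
      using transversal_end_eq[OF assms] by (metis (mono_tags, lifting) image_eqI mem_Collect_eq transversal_tops_def)
  qed
  ultimately show ?thesis by (simp add: bij_betw_def)
qed

lemma hook_permutation:
  assumes \<alpha>: "\<alpha> \<in> partial_brauer_diagrams n" and \<beta>: "\<beta> \<in> partial_brauer_diagrams n"
    and t: "bij_betw t (transversal_tops \<alpha>) (transversal_tops \<beta>)"
    and hooks: "card (upper_hooks \<alpha>) = card (upper_hooks \<beta>)"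
  obtains f where "f permutes {1..n}" "\<And>i. i \<in> transversal_tops \<alpha> \<Longrightarrow> f i = t i"
    "map_prod f f ` upper_hooks \<alpha> = upper_hooks \<beta>"
proof -
  note H = upper_hooks_matching[OF \<alpha>] and K = upper_hooks_matching[OF \<beta>]
  obtain f where f: "f permutes {1..n}" "\<And>i. i \<in> transversal_tops \<alpha> \<Longrightarrow> f i = t i"
      "map_prod f f ` upper_hooks \<alpha> \<subseteq> upper_hooks \<beta>"
    using matching_embedding_permutation[OF _ transversal_tops_subset[OF \<alpha>] transversal_tops_subset[OF \<beta>] t H K]
      hooks by auto
  have "inj (map_prod f f)" using permutes_inj[OF f(1)] by (simp add: prod.inj_map)
  then have "card (map_prod f f ` upper_hooks \<alpha>) = card (upper_hooks \<beta>)"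
    using hooks by (metis card_image inj_on_subset subset_UNIV)
  moreover have "finite (upper_hooks \<beta>)"
    using finite_matching[OF K] by simp
  ultimately have "map_prod f f ` upper_hooks \<alpha> = upper_hooks \<beta>" using f(3) card_subset_eq by blast
  then show thesis using that f by blast
qed

text \<open>
  Any bijection between the upper ends of transversals extends to a permutation \<open>f\<close> that matches up the
  upper hooks. The same is done below, starting from the bijection of the lower ends that makes
  transversals correspond.
\<close>

lemma same_parameters_relabel:
  assumes \<alpha>: "\<alpha> \<in> partial_brauer_diagrams n" and \<beta>: "\<beta> \<in> partial_brauer_diagrams n"
    and rank: "diagram_rank \<alpha> = diagram_rank \<beta>"
    and hooks: "card (upper_hooks \<alpha>) = card (upper_hooks \<beta>)"
      "card (upper_hooks (flip_diagram \<alpha>)) = card (upper_hooks (flip_diagram \<beta>))"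
  obtains f g where "f permutes {1..n}" "g permutes {1..n}" "relabel_diagram f g \<alpha> = \<beta>"
proof -
  note E = matchingsD[OF diagram_edges_matching[OF \<alpha>]] and F = matchingsD[OF diagram_edges_matching[OF \<beta>]]
  let ?S = "transversal_tops \<alpha>" and ?T = "transversal_tops \<beta>"
  have "finite ?S" "finite ?T"
    using finite_subset transversal_tops_subset \<alpha> \<beta> by blast+
  then obtain t where t: "bij_betw t ?S ?T"
    using rank finite_same_card_bij unfolding diagram_rank_eq[OF \<alpha>] diagram_rank_eq[OF \<beta>] by blast
  obtain f where f: "f permutes {1..n}" "\<And>i. i \<in> ?S \<Longrightarrow> f i = t i"
      "map_prod f f ` upper_hooks \<alpha> = upper_hooks \<beta>"
    by (rule hook_permutation[OF \<alpha> \<beta> t hooks(1)]) (rule that, assumption, blast+)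
  \<comment> \<open>on the lower ends of transversals the second permutation is forced by the first\<close>
  let ?t = "transversal_end \<beta> \<circ> t \<circ> inv_into ?S (transversal_end \<alpha>)"
  have "bij_betw ?t (transversal_tops (flip_diagram \<alpha>)) (transversal_tops (flip_diagram \<beta>))"
    using bij_betw_inv_into[OF bij_betw_transversal_end[OF \<alpha>]] t bij_betw_transversal_end[OF \<beta>]
    by (intro bij_betw_trans)
  then obtain g where g: "g permutes {1..n}" "\<And>j. j \<in> transversal_tops (flip_diagram \<alpha>) \<Longrightarrow> g j = ?t j"
      "map_prod g g ` upper_hooks (flip_diagram \<alpha>) = upper_hooks (flip_diagram \<beta>)"
    using hook_permutation[OF flip_diagram_PB[OF \<alpha>] flip_diagram_PB[OF \<beta>] _ hooks(2)] by blast
  have g_end: "g (transversal_end \<alpha> i) = transversal_end \<beta> (f i)" if "i \<in> ?S" for i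
  proof -
    have "transversal_end \<alpha> i \<in> transversal_tops (flip_diagram \<alpha>)"
      using bij_betwE[OF bij_betw_transversal_end[OF \<alpha>]] that by blast
    moreover have "inv_into ?S (transversal_end \<alpha>) (transversal_end \<alpha> i) = i"
      using bij_betw_transversal_end[OF \<alpha>] that by (simp add: bij_betw_def)
    ultimately show ?thesis using g(2) f(2)[OF that] by simp
  qed
  let ?\<rho> = "relabel_vertex f id g"
  have \<rho>: "inj ?\<rho>" "?\<rho> ` diagram_vertices n = diagram_vertices n"
    using inj_relabel_vertex[OF permutes_inj[OF f(1)] inj_on_id permutes_inj[OF g(1)]] relabel_vertices[OF f(1) g(1)] by auto
  have trans: "(Upper (f i), Lower (g j)) \<in> diagram_edges \<beta>" if ij: "(Upper i, Lower j) \<in> diagram_edges \<alpha>" for i j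
  proof -
    have i: "i \<in> ?S" using ij by (auto simp: transversal_tops_def)
    have "f i \<in> ?T" using f(2)[OF i] bij_betwE[OF t] i by simp
    then show ?thesis
      using transversal_end_edge[OF \<beta>, of "f i"] g_end[OF i] transversal_end_eq[OF \<alpha> ij] by simp
  qed
  have sub: "map_prod ?\<rho> ?\<rho> ` diagram_edges \<alpha> \<subseteq> diagram_edges \<beta>"
  proof (rule image_subsetI)
    fix e assume e: "e \<in> diagram_edges \<alpha>"
    obtain u v where uv: "e = (u, v)" by (cases e)
    have "u \<in> diagram_vertices n" "v \<in> diagram_vertices n" using e uv E(1,2) by blast+
    then consider i j where "u = Upper i" "v = Upper j" | i j where "u = Upper i" "v = Lower j"
      | i j where "u = Lower i" "v = Upper j" | i j where "u = Lower i" "v = Lower j"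
      by (metis diagram_vertices_cases)
    then show "map_prod ?\<rho> ?\<rho> e \<in> diagram_edges \<beta>"
    proof cases
      case (1 i j)
      then have "(i, j) \<in> upper_hooks \<alpha>" using e uv by (simp add: upper_hooks_def)
      from imageI[OF this, of "map_prod f f"] have "(f i, f j) \<in> upper_hooks \<beta>" using f(3) by simp
      then show ?thesis using 1 uv by (simp add: upper_hooks_def)
    next
      case (2 i j) then show ?thesis using trans e uv by simp
    next
      case (3 i j) then show ?thesis using trans[of j i] e uv E(3) F(3) by simp
    next
      case (4 i j)
      then have "(i, j) \<in> upper_hooks (flip_diagram \<alpha>)" using e uv by (simp add: upper_hooks_def edges_flip)
      from imageI[OF this, of "map_prod g g"] have "(g i, g j) \<in> upper_hooks (flip_diagram \<beta>)" using g(3) by simp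
      then show ?thesis using 4 uv by (simp add: upper_hooks_def edges_flip)
    qed
  qed
  have "diagram_edges \<beta> \<subseteq> map_prod ?\<rho> ?\<rho> ` diagram_edges \<alpha>"
  proof
    have trans': "\<exists>k l. i = f k \<and> j = g l \<and> (Upper k, Lower l) \<in> diagram_edges \<alpha>"
      if ij: "(Upper i, Lower j) \<in> diagram_edges \<beta>" for i j
    proof -
      have "i \<in> ?T" using ij by (auto simp: transversal_tops_def)
      then obtain k where k: "k \<in> ?S" "i = t k" using t by (auto simp: bij_betw_def)
      have "j = g (transversal_end \<alpha> k)" using g_end[OF k(1)] f(2)[OF k(1)] k(2) transversal_end_eq[OF \<beta> ij] by simp
      then show ?thesis using k f(2) transversal_end_edge[OF \<alpha> k(1)] by metis
    qed
    fix e assume e: "e \<in> diagram_edges \<beta>"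
    obtain u v where uv: "e = (u, v)" by (cases e)
    have "u \<in> diagram_vertices n" "v \<in> diagram_vertices n" using e uv F(1,2) by blast+
    then consider i j where "u = Upper i" "v = Upper j" | i j where "u = Upper i" "v = Lower j"
      | i j where "u = Lower i" "v = Upper j" | i j where "u = Lower i" "v = Lower j"
      by (metis diagram_vertices_cases)
    then have "\<exists>d\<in>diagram_edges \<alpha>. e = map_prod ?\<rho> ?\<rho> d"
    proof cases
      case (1 i j)
      then have "(i, j) \<in> map_prod f f ` upper_hooks \<alpha>" using e uv f(3) by (simp add: upper_hooks_def)
      then obtain k l where "i = f k" "j = f l" "(Upper k, Upper l) \<in> diagram_edges \<alpha>" by (auto simp: upper_hooks_def)
      then show ?thesis using 1 uv by (intro bexI[of _ "(Upper k, Upper l)"]) auto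
    next
      case (2 i j)
      then obtain k l where "i = f k" "j = g l" "(Upper k, Lower l) \<in> diagram_edges \<alpha>" using trans' e uv by blast
      then show ?thesis using 2 uv by (intro bexI[of _ "(Upper k, Lower l)"]) auto
    next
      case (3 i j)
      then obtain k l where "j = f k" "i = g l" "(Upper k, Lower l) \<in> diagram_edges \<alpha>" using trans' e uv F(3) by blast
      then show ?thesis using 3 uv E(3) by (intro bexI[of _ "(Lower l, Upper k)"]) auto
    next
      case (4 i j)
      then have "(i, j) \<in> map_prod g g ` upper_hooks (flip_diagram \<alpha>)" using e uv g(3) by (simp add: upper_hooks_def edges_flip)
      then obtain k l where "i = g k" "j = g l" "(Lower k, Lower l) \<in> diagram_edges \<alpha>" by (auto simp: upper_hooks_def edges_flip)
      then show ?thesis using 4 uv by (intro bexI[of _ "(Lower k, Lower l)"]) auto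
    qed
    then show "e \<in> map_prod ?\<rho> ?\<rho> ` diagram_edges \<alpha>" by blast
  qed
  then have "diagram_edges (relabel_diagram f g \<alpha>) = diagram_edges \<beta>"
    using sub by (simp add: diagram_edges_image[OF \<rho>(1)])
  then have "relabel_diagram f g \<alpha> = \<beta>"
    using inj_onD[OF bij_betw_imp_inj_on[OF bij_betw_diagram_edges] _ image_diagram_PB[OF \<rho> \<alpha>] \<beta>] by blast
  then show thesis using that f(1) g(1) by blast
qed

text \<open>
  In \<open>\<xi>\<alpha>\<eta>\<close> the lower points of \<open>\<xi>\<close> meet the upper points of \<open>\<alpha>\<close>, and the upper points of \<open>\<eta>\<close> meet the
  lower points of \<open>\<alpha>\<close>. Hence all other diagrams are relabelled by \<open>g\<close> above and \<open>f\<close> below.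
\<close>

lemma relabel_variant_iso:
  assumes \<alpha>: "\<alpha> \<in> partial_brauer_diagrams n" and f: "f permutes {1..n}" and g: "g permutes {1..n}"
  shows "variant (PB n) \<alpha> \<cong> variant (PB n) (relabel_diagram f g \<alpha>)"
proof (rule variant_isoI[where \<phi> = "relabel_diagram g f"])
  have rel_PB: "relabel_diagram h k \<xi> \<in> partial_brauer_diagrams n"
    if "h permutes {1..n}" "k permutes {1..n}" "\<xi> \<in> partial_brauer_diagrams n" for h k \<xi>
    using image_diagram_PB[OF inj_relabel_vertex[OF permutes_inj inj_on_id permutes_inj] relabel_vertices] that by blast
  define f' g' where "f' = Hilbert_Choice.inv f" and "g' = Hilbert_Choice.inv g"
  have p: "f' permutes {1..n}" "g' permutes {1..n}" using permutes_inv f g by (auto simp: f'_def g'_def)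
  have inv: "f' (f i) = i" "f (f' i) = i" "g' (g i) = i" "g (g' i) = i" for i
    using permutes_inverses[OF f] permutes_inverses[OF g] by (auto simp: f'_def g'_def)
  have comp: "relabel_vertex g' id f' (relabel_vertex g id f v) = v" "relabel_vertex g id f (relabel_vertex g' id f' v) = v" for v
    using inv by (cases v; simp)+
  show "bij_betw (relabel_diagram g f) (partial_brauer_diagrams n) (partial_brauer_diagrams n)"
    by (rule bij_betw_byWitness[where f' = "relabel_diagram g' f'"])
      (use rel_PB f g p in \<open>auto simp: image_image comp\<close>)
  fix \<xi> \<eta> assume PB: "\<xi> \<in> partial_brauer_diagrams n" "\<eta> \<in> partial_brauer_diagrams n"
  show "relabel_diagram g f (diagram_mult n (diagram_mult n \<xi> \<alpha>) \<eta>) =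
    diagram_mult n (diagram_mult n (relabel_diagram g f \<xi>) (relabel_diagram f g \<alpha>)) (relabel_diagram g f \<eta>)"
    using relabel_diagram_mult[OF diagram_mult_closed[OF \<alpha> PB(1)] PB(2) g g f]
      relabel_diagram_mult[OF PB(1) \<alpha> g f g] by simp
qed

theorem theorem4p1:
  fixes m n r s k l p w :: nat and \<alpha> \<beta> :: diagram
  assumes "\<alpha> \<in> carrier (PB m)" and "\<beta> \<in> carrier (PB n)"
    and "r = diagram_rank \<alpha>" and "r \<ge> 1"
    and "s = diagram_rank \<beta>" and "s \<ge> 1"
    and "k = card (singleton_classes {1..m} (diagram_ker m \<alpha>))"
    and "l = card (singleton_classes {1..n} (diagram_ker n \<beta>))"
    and "p = card (singleton_classes {1..m} (diagram_coker m \<alpha>))"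
    and "w = card (singleton_classes {1..n} (diagram_coker n \<beta>))"
  shows "variant (PB m) \<alpha> \<cong> variant (PB n) \<beta> \<longleftrightarrow> m = n \<and> k = l \<and> p = w \<and> r = s"
proof -
  have \<alpha>: "\<alpha> \<in> partial_brauer_diagrams m" and \<beta>: "\<beta> \<in> partial_brauer_diagrams n"
    using assms(1,2) by simp_all
  note \<alpha>' = flip_diagram_PB[OF \<alpha>] and \<beta>' = flip_diagram_PB[OF \<beta>]
  have k: "k + card (upper_hooks \<alpha>) = m" and l: "l + card (upper_hooks \<beta>) = n"
    and p: "p + card (upper_hooks (flip_diagram \<alpha>)) = m" and w: "w + card (upper_hooks (flip_diagram \<beta>)) = n"
    using assms(7-10) singleton_kernel_classes \<alpha> \<beta> \<alpha>' \<beta>' by (auto simp: diagram_coker_flip)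
  show ?thesis
  proof
    assume iso: "variant (PB m) \<alpha> \<cong> variant (PB n) \<beta>"
    have "m = n \<and> r = s \<and> card (upper_hooks \<alpha>) = card (upper_hooks \<beta>)"
      using variant_iso_invariants[OF \<alpha> \<beta> _ _ iso] assms(3-6) by simp
    moreover have "card (upper_hooks (flip_diagram \<alpha>)) = card (upper_hooks (flip_diagram \<beta>))"
      using variant_iso_invariants[OF \<alpha>' \<beta>' _ _ variant_iso_flip[OF \<alpha> \<beta> iso]] assms(3-6)
      by (simp add: diagram_rank_flip)
    ultimately show "m = n \<and> k = l \<and> p = w \<and> r = s" using k l p w by auto
  next
    assume eq: "m = n \<and> k = l \<and> p = w \<and> r = s"
    then have \<alpha>n: "\<alpha> \<in> partial_brauer_diagrams n" using \<alpha> by simp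
    have "diagram_rank \<alpha> = diagram_rank \<beta>" "card (upper_hooks \<alpha>) = card (upper_hooks \<beta>)"
      "card (upper_hooks (flip_diagram \<alpha>)) = card (upper_hooks (flip_diagram \<beta>))"
      using eq k l p w assms(3,5) by auto
    then obtain f g where "f permutes {1..n}" "g permutes {1..n}" "relabel_diagram f g \<alpha> = \<beta>"
      by (rule same_parameters_relabel[OF \<alpha>n \<beta>])
    then show "variant (PB m) \<alpha> \<cong> variant (PB n) \<beta>"
      using relabel_variant_iso[OF \<alpha>n] eq by blast
  qed
qed

end
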